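(* Let $p$ be an arbitrary but fixed prime. Then the series $\sum_{n\ge 2,\ p(n)=p}\frac{\mu(n)\omega(n)}{n}$ converges and $$\sum_{\substack{n\ge 1\\ p(n)=p}}\frac{\mu(n)\omega(n)}{n}=\sum_{\substack{n\ge 2\\ p(n)=p}}\frac{\mu(n)\omega(n)}{n}=0.$$
   Context: $\mu$ is the Möbius function, $\omega(n)$ is the number of distinct prime factors of $n$, and for $n\ge 2$, $p(n)$ is the smallest prime factor of $n$ (the integer $n=1$ is not counted, as it has no prime factor). *)

theory Defs
  imports Complex_Main "HOL-Computational_Algebra.Squarefree"
begin

definition omega :: "nat \<Rightarrow> nat" where
  "omega n = card (prime_factors n)"

definition moebius :: "nat \<Rightarrow> int" where
  "moebius n = (if squarefree n then (-1) ^ card (prime_factors n) else 0)"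

(* The value 0 for n < 2 stands for "undefined": it is not prime, so no condition
   "smallest_prime_factor n = p" with p prime holds at n = 0 or n = 1. *)
definition smallest_prime_factor :: "nat \<Rightarrow> nat" where
  "smallest_prime_factor n = (if n \<ge> 2 then Min (prime_factors n) else 0)"

end

theory Submission
  imports "HOL-Complex_Analysis.Complex_Analysis" "HOL-Real_Asymp.Real_Asymp" "HOL-Library.Discrete_Functions" Defs
begin

text \<open>
  Writing \<open>n = p m\<close>, the partial sums become
  \<open>-1/p\<close> times \<open>\<Sum> \<mu>(m)(\<omega>(m) + 1)/m\<close> over \<open>m\<close> free of primes \<open>\<le> p\<close>.
  Expanding \<open>\<omega>(m) = \<Sum>\<^sub>q\<^sub>|\<^sub>m 1\<close> turns the \<open>\<omega>\<close>-part into
  \<open>-\<Sum>\<^sub>q 1/q \<cdot> A(N/q)\<close>, where \<open>A(N)\<close> is the sum of \<open>\<mu>(k)/k\<close> over \<open>k \<le> N\<close> free of a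
  fixed finite set of primes. As \<open>\<Sum> 1/q\<close> diverges like \<open>log log\<close>, the mere convergence of
  \<open>\<Sum> \<mu>(k)/k\<close> to 0 is not enough, but any saving of a power of \<open>log N\<close> in \<open>A(N)\<close> is: together
  with a dyadic Chebyshev bound for the primes it forces the sum over \<open>q\<close> to 0. The saving
  \<open>(log N) powr (-1/16)\<close> comes from Newman's contour argument with a radius growing with \<open>N\<close>,
  in a zero-free region of \<open>\<zeta>\<close> of polynomial width supplied by the 3-4-1 inequality. Removing
  one prime at a time carries it over from all integers to the restricted sums.
\<close>

section \<open>Moebius sums over integers free of given primes\<close>

text \<open>In the sum of 1/q * A(N/q) two ranges of q behave differently. For small q the argument
  N/q is large and the saving acts. For q near N the argument is bounded and A need not be small,
  but there the primes carry little mass: those between 2^j and 2^(j+1) contribute O(1/j) to the sum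
  of 1/q. With J about log_2 N the total becomes the convolution of 1/j with (J - j)^(-1/16), which
  has size J^(-1/16) log J. In the summand for q, the sum A also omits multiples of q, because
  \<mu>(q k) = 0 when q divides k. So the estimate has to be uniform in q, and the removal of a
  prime is arranged to cost the factor 4 whatever the prime is. The exponent 1/16 arises as follows.
  Up to height R the zero-free region has width of order R^(-8) and 1/\<open>zeta1\<close> is O(R^6)
  in it, so the contour yields 1/R + R^7 exp(-c log N / R^8). Taking R^16 of order log N leaves
  exp(-c sqrt(log N)) in the second term, and even the crude bound exp y \<ge> y brings that term
  down to the size of 1/R.\<close>

definition rough :: "nat set \<Rightarrow> nat set" where
  "rough Q = {n. 0 < n \<and> (\<forall>q\<in>Q. \<not> q dvd n)}"

text \<open>The integers are split by divisibility by q. The multiples of q are q times all of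
  \<open>rough Q\<close>, so powers of q stay in the second part; the zeta sums keep them, while in
  the Moebius sums they vanish.\<close>

lemma rough_split:
  assumes "prime q" "q \<notin> Q" "\<forall>r\<in>Q. prime r"
  shows "rough Q = rough (insert q Q) \<union> (*) q ` rough Q"
    and "rough (insert q Q) \<inter> (*) q ` rough Q = {}"
proof -
  have *: "n \<in> (*) q ` rough Q" if "n \<in> rough Q" "q dvd n" for n
    using that unfolding rough_def by (auto simp: image_iff) (metis dvd_def dvd_mult nat_0_less_mult_iff)
  have "q * k \<in> rough Q" if "k \<in> rough Q" for k
  proof -
    have "\<not> r dvd q" if "r \<in> Q" for r
      using that assms primes_dvd_imp_eq by blast
    then show ?thesis using that assms by (auto simp: rough_def prime_dvd_mult_iff prime_gt_0_nat)
  qed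
  with * show "rough Q = rough (insert q Q) \<union> (*) q ` rough Q"
    by (auto simp: rough_def)
  show "rough (insert q Q) \<inter> (*) q ` rough Q = {}"
    by (auto simp: rough_def)
qed

lemma prime_factors_mult_coprime_prime:
  fixes q k :: nat
  assumes "prime q" "\<not> q dvd k" "k > 0"
  shows "prime_factors (q * k) = insert q (prime_factors k)" "q \<notin> prime_factors k"
  using assms prime_gt_0_nat[OF assms(1)]
  by (auto simp: in_prime_factors_iff prime_dvd_mult_iff primes_dvd_imp_eq)

lemma moebius_prime_mult:
  assumes "prime q" "\<not> q dvd k" "k > 0"
  shows "moebius (q * k) = - moebius k"
proof -
  have "coprime q k" using assms prime_imp_coprime by blast
  then have "squarefree (q * k) \<longleftrightarrow> squarefree k"
    using assms squarefree_mult_coprime[of q k] squarefree_prime[of q] squarefree_multD(2)[of q k]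
    by blast
  with prime_factors_mult_coprime_prime[OF assms] show ?thesis
    by (simp add: moebius_def)
qed

lemma omega_prime_mult:
  assumes "prime q" "\<not> q dvd k" "k > 0"
  shows "omega (q * k) = Suc (omega k)"
  using prime_factors_mult_coprime_prime[OF assms] by (simp add: omega_def)

lemma moebius_prime_mult_dvd:
  assumes "prime q" "q dvd k"
  shows "moebius (q * k) = 0"
proof -
  have "q\<^sup>2 dvd q * k" using assms by (simp add: power2_eq_square)
  then have "\<not> squarefree (q * k)"
    using assms by (metis not_prime_unit squarefree_def)
  then show ?thesis by (simp add: moebius_def)
qed

lemma moebius_abs_le: "\<bar>moebius n\<bar> \<le> 1"
  by (simp add: moebius_def power_abs)

lemma moebius_1 [simp]: "moebius 1 = 1" "moebius (Suc 0) = 1"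
  by (simp_all add: moebius_def)

definition mert :: "nat set \<Rightarrow> nat \<Rightarrow> real" where
  "mert Q N = (\<Sum>k \<in> rough Q \<inter> {..N}. moebius k / k)"

definition mert_omega :: "nat set \<Rightarrow> nat \<Rightarrow> real" where
  "mert_omega Q N = (\<Sum>k \<in> rough Q \<inter> {..N}. moebius k * omega k / k)"

lemma image_mult_atMost:
  fixes q :: nat
  assumes "q > 0"
  shows "(*) q ` A \<inter> {..N} = (*) q ` (A \<inter> {..N div q})"
  using assms by (auto simp: less_eq_div_iff_mult_less_eq mult.commute)

lemma inj_on_mult_nat: "q > 0 \<Longrightarrow> inj_on ((*) (q::nat)) A"
  by (auto simp: inj_on_def)

text \<open>Read from right to left this is a recursion: \<open>mert (insert q Q)\<close> at N is
  given by \<open>mert Q\<close> at N and by itself at the smaller argument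
  \<open>N div q\<close>.\<close>

lemma mert_split:
  assumes "prime q" "q \<notin> Q" "\<forall>r\<in>Q. prime r"
  shows "mert Q N = mert (insert q Q) N - mert (insert q Q) (N div q) / q"
proof -
  note q = prime_gt_0_nat[OF assms(1)]
  let ?f = "\<lambda>k. real_of_int (moebius k) / k"
  have "mert Q N = sum ?f (rough (insert q Q) \<inter> {..N} \<union> (*) q ` rough Q \<inter> {..N})"
    unfolding mert_def using rough_split(1)[OF assms] by (metis Int_Un_distrib2)
  also have "\<dots> = mert (insert q Q) N + sum ?f ((*) q ` rough Q \<inter> {..N})"
    unfolding mert_def by (rule sum.union_disjoint) (use rough_split(2)[OF assms] in auto)
  also have "sum ?f ((*) q ` rough Q \<inter> {..N}) = (\<Sum>k\<in>rough Q \<inter> {..N div q}. ?f (q * k))"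
    using q by (simp add: image_mult_atMost sum.reindex inj_on_mult_nat)
  also have "\<dots> = (\<Sum>k\<in>rough (insert q Q) \<inter> {..N div q}. ?f (q * k))"
    by (rule sum.mono_neutral_right)
      (auto simp: rough_def moebius_prime_mult_dvd[OF assms(1)])
  also have "\<dots> = (\<Sum>k\<in>rough (insert q Q) \<inter> {..N div q}. - ?f k / q)"
    by (rule sum.cong) (auto simp: rough_def moebius_prime_mult[OF assms(1)])
  finally show ?thesis
    by (simp add: mert_def sum_negf sum_divide_distrib)
qed

lemma mert_omega_eq:
  assumes "\<forall>r\<in>Q. prime r"
  shows "mert_omega Q N = - (\<Sum>q | prime q \<and> q \<notin> Q \<and> q \<le> N. mert (insert q Q) (N div q) / q)"
proof -
  let ?P = "{q. prime q \<and> q \<notin> Q \<and> q \<le> N}"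
  let ?f = "\<lambda>k. real_of_int (moebius k) / k"
  have fin: "finite ?P" by simp
  have om: "?f k * omega k = (\<Sum>q\<in>?P. if q dvd k then ?f k else 0)" if "k \<in> rough Q \<inter> {..N}" for k
  proof -
    \<comment> \<open>Since 0 < k \<le> N, every prime factor of k is at most N; so the primes range
      over a finite set independent of k and the two sums can be exchanged.\<close>
    have "prime_factors k = {q \<in> ?P. q dvd k}"
      using that by (auto simp: rough_def in_prime_factors_iff intro: order_trans[OF dvd_imp_le])
    then show ?thesis
      using fin by (simp add: omega_def sum.inter_filter [symmetric] mult.commute)
  qed
  have inner: "(\<Sum>k\<in>rough Q \<inter> {..N}. if q dvd k then ?f k else 0) = - mert (insert q Q) (N div q) / q"
    if q: "prime q" "q \<notin> Q" for q
  proof -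
    note q0 = prime_gt_0_nat[OF q(1)]
    have "(\<Sum>k\<in>rough Q \<inter> {..N}. if q dvd k then ?f k else 0) = sum ?f {k \<in> rough Q \<inter> {..N}. q dvd k}"
      by (subst sum.inter_filter) auto
    also have "{k \<in> rough Q \<inter> {..N}. q dvd k} = (*) q ` rough Q \<inter> {..N}"
      using rough_split[OF q assms] by (auto simp: rough_def)
    also have "sum ?f \<dots> = (\<Sum>k\<in>rough Q \<inter> {..N div q}. ?f (q * k))"
      using q0 by (simp add: image_mult_atMost sum.reindex inj_on_mult_nat)
    also have "\<dots> = (\<Sum>k\<in>rough (insert q Q) \<inter> {..N div q}. ?f (q * k))"
      by (rule sum.mono_neutral_right)
        (auto simp: rough_def moebius_prime_mult_dvd[OF q(1)])
    also have "\<dots> = (\<Sum>k\<in>rough (insert q Q) \<inter> {..N div q}. - ?f k / q)"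
      by (rule sum.cong) (auto simp: rough_def moebius_prime_mult[OF q(1)])
    finally show ?thesis
      by (simp add: mert_def sum_negf sum_divide_distrib)
  qed
  have "mert_omega Q N = (\<Sum>k\<in>rough Q \<inter> {..N}. \<Sum>q\<in>?P. if q dvd k then ?f k else 0)"
    unfolding mert_omega_def using om by (intro sum.cong) auto
  also have "\<dots> = (\<Sum>q\<in>?P. \<Sum>k\<in>rough Q \<inter> {..N}. if q dvd k then ?f k else 0)"
    by (rule sum.swap)
  also have "\<dots> = (\<Sum>q\<in>?P. - mert (insert q Q) (N div q) / q)"
    using inner by (intro sum.cong) auto
  finally show ?thesis by (simp add: sum_negf)
qed

section \<open>Chebyshev's upper bound for primes in dyadic intervals\<close>

lemma prod_primes_dvd_nat:
  fixes n :: nat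
  assumes "finite P" "\<And>q. q \<in> P \<Longrightarrow> prime q" "\<And>q. q \<in> P \<Longrightarrow> q dvd n"
  shows "\<Prod>P dvd n"
  using assms
proof (induction P)
  case (insert q P)
  have "coprime q (\<Prod>P)"
    using insert by (intro prod_coprime_right) (metis insertCI primes_coprime)
  then show ?case using insert by (simp add: divides_mult)
qed auto

lemma card_primes_dyadic:
  "real (card {q::nat. prime q \<and> 2 ^ j < q \<and> q \<le> 2 ^ Suc j}) \<le> 4 * 2 ^ j / Suc j"
proof (cases "j = 0")
  case True
  then have "{q::nat. prime q \<and> 2 ^ j < q \<and> q \<le> 2 ^ Suc j} = {2}" by auto
  then show ?thesis using True by simp
next
  case False
  let ?P = "{q::nat. prime q \<and> 2 ^ j < q \<and> q \<le> 2 ^ Suc j}"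
  let ?n = "2 ^ j :: nat"
  have fin: "finite ?P" by (rule finite_subset[of _ "{..2 ^ Suc j}"]) auto
  \<comment> \<open>Chebyshev: these primes all divide a central binomial coefficient, which is at most \<open>4\<^sup>n\<close>.\<close>
  have dvd: "q dvd ((2 * ?n) choose ?n)" if "q \<in> ?P" for q
  proof -
    have q: "prime q" "?n < q" "q \<le> 2 * ?n" using that by auto
    have "fact ?n * fact (2 * ?n - ?n) * ((2 * ?n) choose ?n) = (fact (2 * ?n) :: nat)"
      by (rule binomial_fact_lemma) simp
    moreover have "q dvd (fact (2 * ?n) :: nat)" using q by (simp add: prime_dvd_fact_iff)
    moreover have "\<not> q dvd (fact ?n :: nat)" using q by (simp add: prime_dvd_fact_iff)
    moreover have "2 * ?n - ?n = ?n" by simp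
    ultimately show ?thesis using q(1) by (metis prime_dvd_mult_iff)
  qed
  have "?n ^ card ?P = (\<Prod>q\<in>?P. ?n)" by simp
  also have "\<dots> \<le> \<Prod>?P" by (rule prod_mono) auto
  also have "\<dots> \<le> ((2 * ?n) choose ?n)"
    using prod_primes_dvd_nat[OF fin _ dvd] by (intro dvd_imp_le) auto
  also have "\<dots> \<le> 2 ^ (2 * ?n)" by (rule binomial_le_pow2)
  finally have "2 ^ (j * card ?P) \<le> (2 ^ (2 * ?n) :: nat)" by (simp add: power_mult)
  then have "j * card ?P \<le> 2 * ?n" by simp
  then have "real j * card ?P \<le> 2 * 2 ^ j"
    by (metis (mono_tags, lifting) of_nat_le_iff of_nat_mult of_nat_numeral of_nat_power)
  then have "card ?P \<le> 2 * 2 ^ j / real j"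
    using False by (simp add: field_simps)
  \<comment> \<open>For j \<ge> 1 one has \<open>Suc j\<close> \<le> 2 j; the weaker form with
    \<open>Suc j\<close> makes sense at j = 0 as well.\<close>
  also have "\<dots> \<le> 4 * 2 ^ j / Suc j" using False by (simp add: field_simps)
  finally show ?thesis .
qed

section \<open>The zeta function near the line of real part 1\<close>

text \<open>
  \<open>zeta1 s\<close> is \<open>(s - 1) \<zeta>(s)\<close>: for \<open>Re s > 1\<close> the last two powers telescope to \<open>-1\<close>, and the
  summand equals \<open>(s - 1)\<close> times the integral of \<open>n\<^bsup>-s\<^esup> - x\<^bsup>-s\<^esup>\<close> over \<open>n \<le> x \<le> n + 1\<close>, which
  makes the series converge for \<open>Re s > 0\<close>.
\<close>

definition zeta_term :: "nat \<Rightarrow> complex \<Rightarrow> complex" where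
  "zeta_term n s = (s - 1) * of_nat n powr (-s) - of_nat n powr (1 - s) + of_nat (Suc n) powr (1 - s)"

definition zeta1 :: "complex \<Rightarrow> complex" where
  "zeta1 s = 1 + (\<Sum>n. zeta_term (Suc n) s)"

lemma powr_le_powr_of_nonpos:
  fixes n x :: real
  assumes "n > 0" "n \<le> x" "a \<le> 0"
  shows "x powr a \<le> n powr a"
  using assms by (intro powr_mono2') auto

text \<open>The term is the increment over [n, n + 1] of the function \<open>h\<close> below, whose
  derivative (s - 1)(n^(-s) - z^(-s)) vanishes at n. Two applications of the mean value inequality
  on the segment therefore gain the extra factor 1/n.\<close>

lemma zeta_term_bound:
  assumes "n > 0" "Re s > 0"
  shows "norm (zeta_term n s) \<le> norm s * norm (s - 1) * real n powr (- Re s - 1)"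
proof -
  define S :: "complex set" where "S = closed_segment (of_nat n) (of_nat (Suc n))"
  have conv: "convex S" by (simp add: S_def)
  have S: "\<exists>x. z = of_real x \<and> real n \<le> x \<and> x \<le> real n + 1" if z: "z \<in> S" for z
  proof -
    obtain u where u: "0 \<le> u" "u \<le> 1" "z = (1 - u) *\<^sub>R of_nat n + u *\<^sub>R of_nat (Suc n)"
      using z by (auto simp only: S_def in_segment)
    then have "z = of_real (real n + u)"
      by (simp add: scaleR_conv_of_real algebra_simps)
    with u show ?thesis by (intro exI[of _ "real n + u"]) auto
  qed
  have nonneg: "z \<notin> \<real>\<^sub>\<le>\<^sub>0" if "z \<in> S" for z
    using S[OF that] assms by (auto simp: complex_nonpos_Reals_iff)
  define B where "B = norm s * real n powr (- Re s - 1)"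
  have lip: "norm (z powr (-s) - w powr (-s)) \<le> B * norm (z - w)" if "z \<in> S" "w \<in> S" for z w
  proof (rule field_differentiable_bound[OF conv _ _ that])
    show "((\<lambda>z. z powr (-s)) has_field_derivative -s * z powr (-s - 1)) (at z within S)" if "z \<in> S" for z
      using nonneg[OF that] by (auto intro!: derivative_eq_intros has_field_derivative_powr)
    show "norm (-s * z powr (-s - 1)) \<le> B" if z: "z \<in> S" for z
    proof -
      obtain x where x: "z = of_real x" "real n \<le> x" using S[OF z] by blast
      have "norm (z powr (-s - 1)) = x powr (- Re s - 1)"
        using x assms by (simp add: norm_powr_real_powr)
      also have "\<dots> \<le> real n powr (- Re s - 1)"
        using x assms by (intro powr_le_powr_of_nonpos) auto
      finally show ?thesis by (simp add: B_def norm_mult mult_left_mono)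
    qed
  qed
  define h where "h = (\<lambda>z. (s - 1) * (z - of_nat n) * of_nat n powr (-s) + z powr (1 - s))"
  have n: "of_nat n \<in> S" "of_nat (Suc n) \<in> S" by (auto simp: S_def)
  have "norm (h (of_nat (Suc n)) - h (of_nat n)) \<le> (norm (s - 1) * B) * norm (of_nat (Suc n) - of_nat n :: complex)"
  proof (rule field_differentiable_bound[OF conv _ _ n(2) n(1)])
    show "(h has_field_derivative (s - 1) * (of_nat n powr (-s) - z powr (-s))) (at z within S)" if "z \<in> S" for z
      unfolding h_def using nonneg[OF that]
      by (auto intro!: derivative_eq_intros simp: algebra_simps)
    show "norm ((s - 1) * (of_nat n powr (-s) - z powr (-s))) \<le> norm (s - 1) * B" if z: "z \<in> S" for z
    proof -
      obtain x where x: "z = of_real x" "real n \<le> x" "x \<le> real n + 1" using S[OF z] by blast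
      have "B \<ge> 0" by (simp add: B_def)
      have "of_nat n - z = of_real (real n - x)" by (simp add: x)
      then have "norm (of_nat n - z) \<le> 1" using x by (simp only: norm_of_real)
      then have "norm (of_nat n powr (-s) - z powr (-s)) \<le> B * 1"
        using lip[OF n(1) that] \<open>B \<ge> 0\<close> by (meson mult_left_mono order_trans)
      then show ?thesis by (simp add: norm_mult mult_left_mono)
    qed
  qed
  also have "h (of_nat (Suc n)) - h (of_nat n) = zeta_term n s"
    by (simp add: h_def zeta_term_def)
  finally show ?thesis by (simp add: B_def mult_ac)
qed

text \<open>This is 1 + \<zeta>(3/2): the termwise bound has exponent -Re s - 1, and the estimates
  are made uniform on Re s \<ge> 1/2, which leaves room to the left of the line Re s = 1.\<close>

definition zeta_const :: real where
  "zeta_const = 1 + (\<Sum>n. real (Suc n) powr (-3/2))"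

lemma summable_powr_Suc: "a < -1 \<Longrightarrow> summable (\<lambda>n. real (Suc n) powr a)"
  by (subst summable_Suc_iff) (simp add: summable_real_powr_iff)

lemma zeta_const_ge_1: "zeta_const \<ge> 1"
  unfolding zeta_const_def by (simp add: suminf_nonneg summable_powr_Suc del: of_nat_Suc)

lemma zeta_term_bound':
  assumes "Re s \<ge> 1/2"
  shows "norm (zeta_term (Suc n) s) \<le> norm s * norm (s - 1) * real (Suc n) powr (-3/2)"
proof -
  have "norm (zeta_term (Suc n) s) \<le> norm s * norm (s - 1) * real (Suc n) powr (- Re s - 1)"
    using assms by (intro zeta_term_bound) auto
  also have "real (Suc n) powr (- Re s - 1) \<le> real (Suc n) powr (-3/2)"
    using assms by (intro powr_mono) auto
  finally show ?thesis by (simp add: mult_left_mono)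
qed

text \<open>The factor |s| |s - 1| in the bound for each term makes the growth quadratic; this
  square is the R^2 of the later estimates.\<close>

lemma zeta1_bound:
  assumes "Re s \<ge> 1/2"
  shows "norm (zeta1 s) \<le> zeta_const * (1 + norm s) ^ 2"
proof -
  have sm: "summable (\<lambda>n. real (Suc n) powr (-3/2))" by (rule summable_powr_Suc) simp
  have "norm (\<Sum>n. zeta_term (Suc n) s) \<le> (\<Sum>n. norm s * norm (s - 1) * real (Suc n) powr (-3/2))"
    by (rule norm_suminf_le[OF zeta_term_bound'[OF assms]]) (intro summable_mult sm)
  also have "\<dots> = norm s * norm (s - 1) * (zeta_const - 1)"
    using sm by (simp add: suminf_mult zeta_const_def)
  also have "\<dots> \<le> (1 + norm s) * (1 + norm s) * (zeta_const - 1)"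
    using zeta_const_ge_1 norm_triangle_ineq4[of s 1] by (intro mult_right_mono mult_mono) auto
  finally have "norm (zeta1 s) \<le> 1 + (1 + norm s)^2 * (zeta_const - 1)"
    unfolding zeta1_def using norm_triangle_ineq[of 1 "\<Sum>n. zeta_term (Suc n) s"]
    by (simp add: power2_eq_square)
  moreover have "1 \<le> (1 + norm s)^2" by (simp add: one_le_power)
  moreover have "(1 + norm s)^2 * (zeta_const - 1) = zeta_const * (1 + norm s)^2 - (1 + norm s)^2"
    by (simp add: algebra_simps)
  ultimately show ?thesis by linarith
qed

lemma zeta1_holomorphic: "zeta1 holomorphic_on {s. Re s > 1/2}"
proof (rule holomorphic_uniform_sequence[where f = "\<lambda>n s. 1 + (\<Sum>i<n. zeta_term (Suc i) s)"])
  show "open {s. Re s > 1/2}" by (rule open_halfspace_Re_gt)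
  show "(\<lambda>s. 1 + (\<Sum>i<n. zeta_term (Suc i) s)) holomorphic_on {s. Re s > 1/2}" for n
    unfolding zeta_term_def by (intro holomorphic_intros)
  fix z :: complex assume z: "z \<in> {s. Re s > 1/2}"
  define d where "d = (Re z - 1/2) / 2"
  have d: "d > 0" using z by (simp add: d_def)
  have sub: "Re s > 1/2" if "s \<in> cball z d" for s
  proof -
    have "\<bar>Re (z - s)\<bar> \<le> d" using that abs_Re_le_cmod[of "z - s"] by (simp add: dist_norm)
    moreover have "d < Re z - 1/2" using d unfolding d_def by argo
    ultimately show ?thesis by simp
  qed
  have "uniform_limit (cball z d) (\<lambda>n s. \<Sum>i<n. zeta_term (Suc i) s) (\<lambda>s. \<Sum>n. zeta_term (Suc n) s) sequentially"
  proof (rule Weierstrass_m_test)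
    fix n s assume s: "s \<in> cball z d"
    have "norm s \<le> norm z + d" using s norm_triangle_ineq2[of s z] by (simp add: dist_norm norm_minus_commute)
    moreover have "norm (s - 1) \<le> norm s + 1" using norm_triangle_ineq4[of s 1] by simp
    ultimately have "norm s * norm (s - 1) \<le> (norm z + d) * (norm z + d + 1)"
      using d by (intro mult_mono) auto
    then show "norm (zeta_term (Suc n) s) \<le> (norm z + d) * (norm z + d + 1) * real (Suc n) powr (-3/2)"
      using zeta_term_bound'[of s n] sub[OF s] by (smt (verit) mult_right_mono powr_ge_zero)
  next
    show "summable (\<lambda>n. (norm z + d) * (norm z + d + 1) * real (Suc n) powr (-3/2))"
      by (intro summable_mult summable_powr_Suc) simp
  qed
  then have "uniform_limit (cball z d) (\<lambda>n s. 1 + (\<Sum>i<n. zeta_term (Suc i) s)) zeta1 sequentially"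
    unfolding zeta1_def by (intro uniform_limit_intros)
  then show "\<exists>d>0. cball z d \<subseteq> {s. Re s > 1/2} \<and>
      uniform_limit (cball z d) (\<lambda>n s. 1 + (\<Sum>i<n. zeta_term (Suc i) s)) zeta1 sequentially"
    using d sub by auto
qed

lemma zeta1_1: "zeta1 1 = 1"
  by (simp add: zeta1_def zeta_term_def del: of_nat_Suc)

lemma zeta1_eq:
  assumes "Re s > 1"
  shows "zeta1 s = (s - 1) * (\<Sum>n. of_nat (Suc n) powr (-s))"
proof -
  have sm: "summable (\<lambda>n. of_nat (Suc n) powr (-s))"
    by (rule summable_comparison_test'[where N = 0 and g = "\<lambda>n. real (Suc n) powr (- Re s)"])
       (use assms summable_powr_Suc[of "- Re s"] in \<open>auto simp: norm_powr_real_powr simp del: of_nat_Suc\<close>)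
  have "(\<lambda>n. real (Suc n) powr (1 - Re s)) \<longlonglongrightarrow> 0"
    using assms by real_asymp
  then have "(\<lambda>n. of_nat (Suc n) powr (1 - s)) \<longlonglongrightarrow> 0"
    by (subst tendsto_norm_zero_iff [symmetric]) (simp add: norm_powr_real_powr del: of_nat_Suc)
  from telescope_sums[OF this]
  have "(\<lambda>n. of_nat (Suc (Suc n)) powr (1 - s) - of_nat (Suc n) powr (1 - s)) sums (-1)" by simp
  from sums_add[OF sums_mult[OF summable_sums[OF sm], of "s - 1"] this]
  have "(\<lambda>n. zeta_term (Suc n) s) sums ((s - 1) * (\<Sum>n. of_nat (Suc n) powr (-s)) + (-1))"
    by (simp add: zeta_term_def algebra_simps)
  then show ?thesis by (simp add: zeta1_def sums_iff)
qed

section \<open>Euler products via sums over integers free of small primes\<close>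

lemma abs_summable_dirichlet_powr:
  assumes "Re s > 1" "\<And>n. norm (c n :: complex) \<le> 1"
  shows "(\<lambda>n. norm (c n * of_nat n powr (-s))) summable_on A"
proof -
  have "summable (\<lambda>n. norm (c n * of_nat n powr (-s)))"
  proof (rule summable_comparison_test'[where N = 0 and g = "\<lambda>n. real n powr (- Re s)"])
    show "summable (\<lambda>n. real n powr (- Re s))"
      using assms by (simp add: summable_real_powr_iff)
    show "norm (norm (c n * of_nat n powr (-s))) \<le> real n powr (- Re s)" for n
      using mult_right_mono[OF assms(2)[of n], of "real n powr (- Re s)"]
      by (simp add: norm_mult norm_powr_real_powr)
  qed
  then have "(\<lambda>n. norm (c n * of_nat n powr (-s))) summable_on UNIV"
    by (intro norm_summable_imp_summable_on) simp
  then show ?thesis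
    by (rule summable_on_subset_banach) simp
qed

text \<open>An integer other than 1 without prime factors up to X exceeds X, so the sum differs from
  \<open>f 1\<close> by at most a tail of an absolutely convergent series.\<close>

lemma infsum_rough_primes_tendsto:
  fixes f :: "nat \<Rightarrow> complex"
  assumes f: "(\<lambda>n. norm (f n)) summable_on UNIV"
  shows "(\<lambda>X. \<Sum>\<^sub>\<infinity>n\<in>rough {q. prime q \<and> q \<le> X}. f n) \<longlonglongrightarrow> f 1"
proof -
  define B where "B X = rough {q. prime q \<and> q \<le> X} - {1}" for X
  have eq: "rough {q. prime q \<and> q \<le> X} = insert 1 (B X)" for X
    by (auto simp: B_def rough_def)
  have sub: "B X \<subseteq> {X<..}" for X
  proof
    fix n assume n: "n \<in> B X"
    then have "n \<noteq> 1" "n > 0" by (auto simp: B_def rough_def)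
    then obtain q where q: "prime q" "q dvd n" using prime_factor_nat by blast
    then have "q \<le> n" using \<open>n > 0\<close> by (simp add: dvd_imp_le)
    moreover have "\<not> q \<le> X" using n q by (auto simp: B_def rough_def)
    ultimately show "n \<in> {X<..}" by simp
  qed
  have fs: "(\<lambda>n. norm (f n)) summable_on A" for A
    using f by (rule summable_on_subset_banach) simp
  define T where "T = (\<Sum>\<^sub>\<infinity>n. norm (f n))"
  have "((\<lambda>n. norm (f n)) has_sum T) UNIV" using f by (simp add: T_def)
  then have "(\<lambda>n. norm (f n)) sums T" by (rule has_sum_imp_sums)
  then have lim: "(\<lambda>X. T - (\<Sum>n\<le>X. norm (f n))) \<longlonglongrightarrow> 0"
    unfolding sums_def_le using tendsto_diff[OF tendsto_const[of T]] by fastforce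
  have "norm ((\<Sum>\<^sub>\<infinity>n\<in>rough {q. prime q \<and> q \<le> X}. f n) - f 1) \<le> T - (\<Sum>n\<le>X. norm (f n))" for X
  proof -
    have "(\<Sum>\<^sub>\<infinity>n\<in>insert 1 (B X). f n) = f 1 + infsum f (B X)"
      by (rule infsum_insert) (use fs abs_summable_summable in \<open>auto simp: B_def\<close>)
    then have "norm ((\<Sum>\<^sub>\<infinity>n\<in>rough {q. prime q \<and> q \<le> X}. f n) - f 1) = norm (infsum f (B X))"
      by (simp add: eq)
    also have "\<dots> \<le> (\<Sum>\<^sub>\<infinity>n\<in>B X. norm (f n))" by (rule norm_infsum_bound[OF fs])
    also have "\<dots> \<le> (\<Sum>\<^sub>\<infinity>n\<in>{X<..}. norm (f n))"
      by (rule infsum_mono2) (use fs sub in auto)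
    also have "T = (\<Sum>\<^sub>\<infinity>n\<in>{..X} \<union> {X<..}. norm (f n))"
      unfolding T_def by (rule arg_cong2[where f = infsum]) auto
    then have "(\<Sum>\<^sub>\<infinity>n\<in>{X<..}. norm (f n)) = T - (\<Sum>n\<le>X. norm (f n))"
      by (subst (asm) infsum_Un_disjoint) (use fs in auto)
    finally show ?thesis .
  qed
  then have "(\<lambda>X. (\<Sum>\<^sub>\<infinity>n\<in>rough {q. prime q \<and> q \<le> X}. f n) - f 1) \<longlonglongrightarrow> 0"
    by (intro Lim_null_comparison[OF always_eventually lim]) auto
  then show ?thesis by (simp add: LIM_zero_iff)
qed

definition zeta_rough :: "nat set \<Rightarrow> complex \<Rightarrow> complex" where
  "zeta_rough Q s = (\<Sum>\<^sub>\<infinity>n\<in>rough Q. of_nat n powr (-s))"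

definition moebius_rough :: "nat set \<Rightarrow> complex \<Rightarrow> complex" where
  "moebius_rough Q s = (\<Sum>\<^sub>\<infinity>n\<in>rough Q. of_int (moebius n) * of_nat n powr (-s))"

lemma norm_of_int_moebius_le: "norm (of_int (moebius n) :: complex) \<le> 1"
  using moebius_abs_le[of n] by simp

lemma of_nat_mult_powr: "of_nat (a * b) powr s = of_nat a powr s * of_nat b powr (s::complex)"
  by (simp add: powr_times_real)

lemma zeta_rough_insert:
  assumes "Re s > 1" "prime q" "q \<notin> Q" "\<forall>r\<in>Q. prime r"
  shows "zeta_rough (insert q Q) s = (1 - of_nat q powr (-s)) * zeta_rough Q s"
proof -
  have sm: "(\<lambda>n. of_nat n powr (-s)) summable_on A" for A
    using abs_summable_dirichlet_powr[OF assms(1), of "\<lambda>_. 1" A] abs_summable_summable by simp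
  have "zeta_rough Q s = zeta_rough (insert q Q) s + (\<Sum>\<^sub>\<infinity>n\<in>(*) q ` rough Q. of_nat n powr (-s))"
    unfolding zeta_rough_def by (subst rough_split(1)[OF assms(2-4)], rule infsum_Un_disjoint)
      (use sm rough_split(2)[OF assms(2-4)] in auto)
  also have "(\<Sum>\<^sub>\<infinity>n\<in>(*) q ` rough Q. of_nat n powr (-s)) = (\<Sum>\<^sub>\<infinity>n\<in>rough Q. of_nat q powr (-s) * of_nat n powr (-s))"
    by (subst infsum_reindex) (use prime_gt_0_nat[OF assms(2)] in \<open>auto simp: inj_on_def o_def of_nat_mult_powr simp del: of_nat_mult\<close>)
  also have "\<dots> = of_nat q powr (-s) * zeta_rough Q s"
    unfolding zeta_rough_def by (rule infsum_cmult_right) (use sm in auto)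
  finally show ?thesis by (simp add: algebra_simps)
qed

text \<open>Compared with \<open>zeta_rough_insert\<close> the Euler factor changes sides: as
  \<mu>(q k) = 0 for q dividing k, the multiples of q contribute -q^(-s) times the sum over
  \<open>rough (insert q Q)\<close>, not over \<open>rough Q\<close>.\<close>

lemma moebius_rough_insert:
  assumes "Re s > 1" "prime q" "q \<notin> Q" "\<forall>r\<in>Q. prime r"
  shows "moebius_rough Q s = (1 - of_nat q powr (-s)) * moebius_rough (insert q Q) s"
proof -
  let ?f = "\<lambda>n. of_int (moebius n) * of_nat n powr (-s) :: complex"
  have sm: "?f summable_on A" for A
    using abs_summable_dirichlet_powr[OF assms(1), of "\<lambda>n. of_int (moebius n)" A, OF norm_of_int_moebius_le]
    by (rule abs_summable_summable)
  have "moebius_rough Q s = moebius_rough (insert q Q) s + infsum ?f ((*) q ` rough Q)"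
    unfolding moebius_rough_def by (subst rough_split(1)[OF assms(2-4)], rule infsum_Un_disjoint)
      (use sm rough_split(2)[OF assms(2-4)] in auto)
  also have "infsum ?f ((*) q ` rough Q) = infsum (\<lambda>n. ?f (q * n)) (rough Q)"
    by (subst infsum_reindex) (use prime_gt_0_nat[OF assms(2)] in \<open>auto simp: inj_on_def o_def\<close>)
  also have "\<dots> = infsum (\<lambda>n. (- (of_nat q powr (-s))) * ?f n) (rough (insert q Q))"
  proof (rule infsum_cong_neutral)
    fix n assume "n \<in> rough Q - rough (insert q Q)"
    then show "?f (q * n) = 0" by (auto simp: rough_def moebius_prime_mult_dvd[OF assms(2)])
  next
    fix n assume "n \<in> rough Q \<inter> rough (insert q Q)"
    then show "?f (q * n) = (- (of_nat q powr (-s))) * ?f n"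
      by (auto simp: rough_def moebius_prime_mult[OF assms(2)] of_nat_mult_powr simp del: of_nat_mult)
  qed (auto simp: rough_def)
  also have "\<dots> = (- (of_nat q powr (-s))) * moebius_rough (insert q Q) s"
    unfolding moebius_rough_def by (rule infsum_cmult_right) (use sm in auto)
  finally show ?thesis by (simp add: algebra_simps)
qed

lemma euler_zeta_rough:
  assumes "Re s > 1" "finite Q" "\<forall>r\<in>Q. prime r"
  shows "zeta_rough Q s = (\<Prod>q\<in>Q. 1 - of_nat q powr (-s)) * zeta_rough {} s"
  using assms(2,3) by (induction Q) (auto simp: zeta_rough_insert[OF assms(1)])

lemma euler_moebius_rough:
  assumes "Re s > 1" "finite Q" "\<forall>r\<in>Q. prime r"
  shows "moebius_rough {} s = (\<Prod>q\<in>Q. 1 - of_nat q powr (-s)) * moebius_rough Q s"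
  using assms(2,3) by (induction Q) (auto simp: moebius_rough_insert[OF assms(1)])

lemma zeta_rough_tendsto:
  assumes "Re s > 1"
  shows "(\<lambda>X. zeta_rough {q. prime q \<and> q \<le> X} s) \<longlonglongrightarrow> 1"
  using infsum_rough_primes_tendsto[of "\<lambda>n. of_nat n powr (-s)"]
    abs_summable_dirichlet_powr[OF assms, of "\<lambda>_. 1"] by (simp add: zeta_rough_def)

lemma moebius_rough_tendsto:
  assumes "Re s > 1"
  shows "(\<lambda>X. moebius_rough {q. prime q \<and> q \<le> X} s) \<longlonglongrightarrow> 1"
  using infsum_rough_primes_tendsto[of "\<lambda>n. of_int (moebius n) * of_nat n powr (-s)"]
    abs_summable_dirichlet_powr[OF assms(1), of "\<lambda>n. of_int (moebius n)" UNIV, OF norm_of_int_moebius_le] by (simp add: moebius_rough_def)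

text \<open>Removing the primes up to X multiplies one factor by a finite Euler product and divides
  the other by it. The product is thus constant in X, while both factors tend to 1.\<close>

lemma moebius_times_zeta:
  assumes "Re s > 1"
  shows "moebius_rough {} s * zeta_rough {} s = 1"
proof -
  have "moebius_rough {} s * zeta_rough {} s
      = moebius_rough {q. prime q \<and> q \<le> X} s * zeta_rough {q. prime q \<and> q \<le> X} s" for X
  proof -
    have "finite {q. prime q \<and> q \<le> X}" "\<forall>r\<in>{q. prime q \<and> q \<le> X}. prime r" by auto
    from euler_moebius_rough[OF assms this] euler_zeta_rough[OF assms this]
    show ?thesis by (simp only: mult.assoc mult.left_commute)
  qed
  then have "(\<lambda>X::nat. moebius_rough {} s * zeta_rough {} s) \<longlonglongrightarrow> 1 * 1"
    using tendsto_mult[OF moebius_rough_tendsto[OF assms] zeta_rough_tendsto[OF assms]] by simp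
  then show ?thesis by (simp add: LIMSEQ_const_iff)
qed

lemma euler_product_tendsto:
  assumes "Re s > 1"
  shows "(\<lambda>X. \<Prod>q | prime q \<and> q \<le> X. 1 - of_nat q powr (-s)) \<longlonglongrightarrow> moebius_rough {} s"
proof -
  have nz: "zeta_rough {} s \<noteq> 0" using moebius_times_zeta[OF assms] by auto
  have "(\<Prod>q | prime q \<and> q \<le> X. 1 - of_nat q powr (-s)) = zeta_rough {q. prime q \<and> q \<le> X} s / zeta_rough {} s" for X
  proof -
    have "finite {q. prime q \<and> q \<le> X}" "\<forall>r\<in>{q. prime q \<and> q \<le> X}. prime r" by auto
    from euler_zeta_rough[OF assms this] show ?thesis
      using nz by (metis nonzero_mult_div_cancel_right)
  qed
  moreover have "1 / zeta_rough {} s = moebius_rough {} s"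
    using moebius_times_zeta[OF assms] nz by (simp add: field_simps)
  ultimately show ?thesis
    using tendsto_divide[OF zeta_rough_tendsto[OF assms] tendsto_const nz] by simp
qed

lemma zeta1_moebius:
  assumes "Re s > 1"
  shows "zeta1 s * moebius_rough {} s = s - 1"
proof -
  have sm: "(\<lambda>n. of_nat n powr (-s)) summable_on A" for A
    using abs_summable_dirichlet_powr[OF assms(1), of "\<lambda>_. 1" A] abs_summable_summable by simp
  have "zeta_rough {} s = (\<Sum>\<^sub>\<infinity>n. of_nat n powr (-s))"
    unfolding zeta_rough_def by (rule infsum_cong_neutral) (auto simp: rough_def)
  then have "(\<lambda>n. of_nat n powr (-s)) sums zeta_rough {} s"
    using sm by (intro has_sum_imp_sums) auto
  then have "(\<lambda>n. of_nat (Suc n) powr (-s)) sums zeta_rough {} s"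
    by (subst sums_Suc_iff) simp
  then have "zeta1 s = (s - 1) * zeta_rough {} s"
    by (simp add: zeta1_eq[OF assms] sums_iff)
  moreover have "zeta_rough {} s * moebius_rough {} s = 1"
    using moebius_times_zeta[OF assms] by (simp only: mult.commute)
  ultimately show ?thesis by (simp add: mult.assoc)
qed

section \<open>The 3-4-1 inequality\<close>

lemma ln_norm_one_minus_sums:
  assumes "norm (w::complex) < 1"
  shows "(\<lambda>n. - Re (w ^ n) / real n) sums ln (norm (1 - w))"
proof -
  \<comment> \<open>At n = 0 the division by zero gives 0, so the series effectively starts at n =
    1.\<close>
  have "(\<lambda>n. - (w ^ n) / of_nat n) sums ln (1 - w)"
    using Ln_series'[of "- w"] assms by simp
  then have "(\<lambda>n. Re (- (w ^ n) / of_nat n)) sums Re (ln (1 - w))"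
    by (rule sums_Re)
  moreover have "1 - w \<noteq> 0" using assms by auto
  moreover have "Re (- (w ^ n) / of_nat n) = - Re (w ^ n) / real n" for n
    by (metis Re_divide_of_real of_real_of_nat_eq uminus_complex.simps(1))
  ultimately show ?thesis by simp
qed

text \<open>The logarithm of the left-hand side is a power series in r. With u = z^n on the unit
  circle, its n-th coefficient is -(3 + 4 Re u + Re u^2)/n = -2 (1 + Re u)^2/n \<le> 0. In the
  application r = q^(-\<sigma>) and z = q^(-it), so that z^2 belongs to the ordinate 2t.\<close>

lemma three_four_one_factor:
  fixes z :: complex
  assumes "0 \<le> r" "r < 1" "norm z = 1"
  shows "norm (1 - of_real r :: complex) ^ 3 * norm (1 - of_real r * z) ^ 4 * norm (1 - of_real r * z\<^sup>2) \<le> 1"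
proof -
  define a b c where "a = norm (1 - of_real r :: complex)" and "b = norm (1 - of_real r * z)"
    and "c = norm (1 - of_real r * z\<^sup>2)"
  have n: "norm (of_real r :: complex) < 1" "norm (of_real r * z) < 1" "norm (of_real r * z\<^sup>2) < 1"
    using assms by (auto simp: norm_mult norm_power)
  have pos: "a > 0" "b > 0" "c > 0"
    using n by (auto simp: a_def b_def c_def)
  have s: "(\<lambda>n. 3 * (- Re (of_real r ^ n) / real n) + 4 * (- Re ((of_real r * z) ^ n) / real n)
          + - Re ((of_real r * z\<^sup>2) ^ n) / real n) sums (3 * ln a + 4 * ln b + ln c)"
    unfolding a_def b_def c_def by (intro sums_add sums_mult ln_norm_one_minus_sums n)
  have "3 * (- Re (of_real r ^ n) / real n) + 4 * (- Re ((of_real r * z) ^ n) / real n)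
          + - Re ((of_real r * z\<^sup>2) ^ n) / real n \<le> 0" for n
  proof -
    define u where "u = z ^ n"
    have "norm u = 1" using assms by (simp add: u_def norm_power)
    then have "(Re u)\<^sup>2 + (Im u)\<^sup>2 = 1" by (metis cmod_power2 one_power2)
    then have "Re (u\<^sup>2) = 2 * (Re u)\<^sup>2 - 1" by (simp add: power2_eq_square)
    then have "3 + 4 * Re u + Re (u\<^sup>2) = 2 * (1 + Re u)\<^sup>2" by (simp add: power2_eq_square algebra_simps)
    then have nn: "3 + 4 * Re u + Re (u\<^sup>2) \<ge> 0" by simp
    have alg: "3 * (- a / m) + 4 * (- (a * x) / m) + - (a * y) / m = - (a / m * (3 + 4 * x + y))"
      for a m x y :: real
      by (simp add: divide_inverse algebra_simps)
    have "(of_real r * z) ^ n = of_real (r ^ n) * u" "(of_real r * z\<^sup>2) ^ n = of_real (r ^ n) * u\<^sup>2"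
      "of_real r ^ n = (of_real (r ^ n) :: complex)"
      by (simp_all add: u_def power_mult_distrib flip: power_mult) (simp add: mult.commute)
    then have "3 * (- Re (of_real r ^ n) / real n) + 4 * (- Re ((of_real r * z) ^ n) / real n)
          + - Re ((of_real r * z\<^sup>2) ^ n) / real n = - (r ^ n / real n * (3 + 4 * Re u + Re (u\<^sup>2)))"
      using alg by (simp only: Re_complex_of_real times_complex.sel Im_complex_of_real mult_zero_left diff_zero)
    with nn assms show ?thesis by simp
  qed
  then have "3 * ln a + 4 * ln b + ln c \<le> 0"
    using sums_le[OF _ s sums_zero] by blast
  moreover have "ln (a ^ 3 * b ^ 4 * c) = 3 * ln a + 4 * ln b + ln c"
    using pos by (simp add: ln_mult ln_realpow)
  ultimately show ?thesis
    using pos unfolding a_def [symmetric] b_def [symmetric] c_def [symmetric]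
    by (smt (verit) ln_le_zero_iff mult_pos_pos zero_less_power)
qed

lemma three_four_one:
  assumes "\<sigma> > 1"
  shows "norm (moebius_rough {} (of_real \<sigma>)) ^ 3 * norm (moebius_rough {} (Complex \<sigma> t)) ^ 4
           * norm (moebius_rough {} (Complex \<sigma> (2 * t))) \<le> 1"
proof -
  let ?P = "\<lambda>s X. \<Prod>q | prime q \<and> q \<le> X. 1 - of_nat q powr (-s) :: complex"
  have lim: "(\<lambda>X. norm (?P (of_real \<sigma>) X) ^ 3 * norm (?P (Complex \<sigma> t) X) ^ 4 * norm (?P (Complex \<sigma> (2 * t)) X))
     \<longlonglongrightarrow> norm (moebius_rough {} (of_real \<sigma>)) ^ 3 * norm (moebius_rough {} (Complex \<sigma> t)) ^ 4
           * norm (moebius_rough {} (Complex \<sigma> (2 * t)))"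
    using assms by (intro tendsto_intros euler_product_tendsto) auto
  have "norm (?P (of_real \<sigma>) X) ^ 3 * norm (?P (Complex \<sigma> t) X) ^ 4 * norm (?P (Complex \<sigma> (2 * t)) X) \<le> 1" for X
  proof -
    have "norm (1 - of_nat q powr (- of_real \<sigma>) :: complex) ^ 3 * norm (1 - of_nat q powr (- Complex \<sigma> t)) ^ 4
        * norm (1 - of_nat q powr (- Complex \<sigma> (2 * t))) \<le> 1" if "prime q" for q :: nat
    proof -
      have q: "q > 1" using that prime_gt_1_nat by blast
      define r where "r = real q powr (- \<sigma>)"
      define z where "z = of_nat q powr (Complex 0 (- t))"
      have r: "0 \<le> r" "r < 1" using q assms by (auto simp: r_def powr_less_one)
      have z: "norm z = 1" using q by (simp add: z_def norm_powr_real_powr)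
      have e1: "of_nat q powr (- of_real \<sigma>) = (of_real r :: complex)"
        using powr_of_real[of "real q" "- \<sigma>"] by (simp add: r_def)
      have "- Complex \<sigma> t = - of_real \<sigma> + Complex 0 (- t)"
        "- Complex \<sigma> (2 * t) = - of_real \<sigma> + (Complex 0 (- t) + Complex 0 (- t))"
        by (auto simp: complex_eq_iff)
      then have e2: "of_nat q powr (- Complex \<sigma> t) = of_real r * z"
        "of_nat q powr (- Complex \<sigma> (2 * t)) = of_real r * z\<^sup>2"
        by (simp_all only: powr_add e1 z_def [symmetric] power2_eq_square)
      show ?thesis unfolding e1 e2 by (rule three_four_one_factor[OF r z])
    qed
    then have "(\<Prod>q | prime q \<and> q \<le> X. norm (1 - of_nat q powr (- of_real \<sigma>) :: complex) ^ 3 * norm (1 - of_nat q powr (- Complex \<sigma> t)) ^ 4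
        * norm (1 - of_nat q powr (- Complex \<sigma> (2 * t)))) \<le> 1"
      by (intro prod_le_1) auto
    then show ?thesis by (simp add: prod.distrib prod_power_distrib prod_norm [symmetric])
  qed
  then show ?thesis by (intro LIMSEQ_le_const2[OF lim]) auto
qed

lemma zeta1_nonzero:
  assumes "Re s > 1"
  shows "zeta1 s \<noteq> 0"
  using zeta1_moebius[OF assms] assms by auto

text \<open>By \<open>zeta1_moebius\<close> the product of the norms of \<open>zeta1\<close> and the
  Moebius series is |s - 1|. This equals \<sigma> - 1 at the real point and is at least |t| at the
  other two; their weights 4 and 1 add up to |t|^5.\<close>

lemma zeta1_three_four_one:
  assumes "\<sigma> > 1"
  shows "(\<sigma> - 1) ^ 3 * \<bar>t\<bar> ^ 5 \<le> norm (zeta1 (of_real \<sigma>)) ^ 3 * norm (zeta1 (Complex \<sigma> t)) ^ 4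
           * norm (zeta1 (Complex \<sigma> (2 * t)))"
proof -
  define z0 z1 z2 where "z0 = norm (zeta1 (of_real \<sigma>))" and "z1 = norm (zeta1 (Complex \<sigma> t))"
    and "z2 = norm (zeta1 (Complex \<sigma> (2 * t)))"
  define m0 m1 m2 where "m0 = norm (moebius_rough {} (of_real \<sigma>))" and "m1 = norm (moebius_rough {} (Complex \<sigma> t))"
    and "m2 = norm (moebius_rough {} (Complex \<sigma> (2 * t)))"
  have "z0 * m0 = norm (of_real \<sigma> - 1 :: complex)"
    using zeta1_moebius[of "of_real \<sigma>"] assms by (simp add: z0_def m0_def flip: norm_mult)
  moreover have "norm (of_real \<sigma> - 1 :: complex) = \<sigma> - 1"
    using assms by (metis abs_of_pos diff_gt_0_iff_gt norm_of_real of_real_1 of_real_diff)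
  ultimately have "(\<sigma> - 1) ^ 3 \<le> (z0 * m0) ^ 3" by simp
  moreover have "z1 * m1 = norm (Complex \<sigma> t - 1)"
    using zeta1_moebius[of "Complex \<sigma> t"] assms by (simp add: z1_def m1_def flip: norm_mult)
  then have "\<bar>t\<bar> ^ 4 \<le> (z1 * m1) ^ 4"
    using abs_Im_le_cmod[of "Complex \<sigma> t - 1"] by (intro power_mono) auto
  moreover have "z2 * m2 = norm (Complex \<sigma> (2 * t) - 1)"
    using zeta1_moebius[of "Complex \<sigma> (2 * t)"] assms by (simp add: z2_def m2_def flip: norm_mult)
  then have "\<bar>t\<bar> \<le> z2 * m2"
    using abs_Im_le_cmod[of "Complex \<sigma> (2 * t) - 1"] by auto
  ultimately have "(\<sigma> - 1) ^ 3 * \<bar>t\<bar> ^ 4 * \<bar>t\<bar> \<le> (z0 * m0) ^ 3 * (z1 * m1) ^ 4 * (z2 * m2)"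
    using assms by (intro mult_mono) (auto simp: z0_def m0_def)
  also have "\<dots> = (z0 ^ 3 * z1 ^ 4 * z2) * (m0 ^ 3 * m1 ^ 4 * m2)"
    by (simp add: power_mult_distrib mult_ac)
  also have "\<dots> \<le> (z0 ^ 3 * z1 ^ 4 * z2) * 1"
    using three_four_one[OF assms, of t]
    by (intro mult_left_mono) (auto simp: m0_def m1_def m2_def z0_def z1_def z2_def)
  finally show ?thesis by (simp add: z0_def z1_def z2_def power_numeral_reduce mult_ac)
qed

section \<open>A zero-free region with a lower bound for zeta1\<close>

lemma norm_le_strip:
  assumes "0 \<le> Re s" "Re s \<le> a" "\<bar>Im s\<bar> \<le> b"
  shows "norm s \<le> a + b"
  using cmod_le[of s] assms by auto

text \<open>Cauchy's inequality on discs of radius 1/8, which stay in Re > 1/2 and where 1 + |w|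
  \<le> 5 R, bounds the derivative by 8 * 25 * \<open>zeta_const\<close> * R^2. The 200 is rounded
  up to a power of two; the convex rectangle then allows the mean value inequality.\<close>

lemma zeta1_lipschitz:
  assumes R: "R \<ge> 1" and "3/4 \<le> Re s" "Re s \<le> 2" "\<bar>Im s\<bar> \<le> R" "3/4 \<le> Re s'" "Re s' \<le> 2" "\<bar>Im s'\<bar> \<le> R"
  shows "norm (zeta1 s - zeta1 s') \<le> 512 * zeta_const * R\<^sup>2 * norm (s - s')"
proof -
  define S where "S = {s. 3/4 \<le> Re s} \<inter> {s. Re s \<le> 2} \<inter> ({s. Im s \<le> R} \<inter> {s. Im s \<ge> -R})"
  have conv: "convex S" unfolding S_def
    by (intro convex_Int convex_halfspace_Re_le convex_halfspace_Re_ge convex_halfspace_Im_le convex_halfspace_Im_ge)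
  have op: "open {s. Re s > 1/2}" by (rule open_halfspace_Re_gt)
  show ?thesis
  proof (rule field_differentiable_bound[OF conv])
    fix z assume z: "z \<in> S"
    then show "(zeta1 has_field_derivative deriv zeta1 z) (at z within S)"
      using holomorphic_derivI[OF zeta1_holomorphic op] by (auto simp: S_def)
    have near: "Re w > 1/2" "norm w \<le> 3 + R" if "norm (z - w) \<le> 1/8" for w
    proof -
      have "\<bar>Re z - Re w\<bar> \<le> 1/8" "\<bar>Im z - Im w\<bar> \<le> 1/8"
        using that abs_Re_le_cmod[of "z - w"] abs_Im_le_cmod[of "z - w"] by auto
      then have "Re z - 1/8 \<le> Re w" "Re w \<le> Re z + 1/8" "\<bar>Im w\<bar> \<le> \<bar>Im z\<bar> + 1/8"
        by arith+
      moreover have "3/4 \<le> Re z" "Re z \<le> 2" "\<bar>Im z\<bar> \<le> R" using z by (auto simp: S_def)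
      ultimately have "1/2 < Re w" "Re w \<le> 2 + 1/8" "\<bar>Im w\<bar> \<le> R + 1/8" by linarith+
      then show "Re w > 1/2" "norm w \<le> 3 + R"
        using norm_le_strip[of w "2 + 1/8" "R + 1/8"] by auto
    qed
    have hol: "zeta1 holomorphic_on cball z (1/8)"
      by (rule holomorphic_on_subset[OF zeta1_holomorphic]) (use near in \<open>auto simp: dist_norm\<close>)
    have "norm ((deriv ^^ 1) zeta1 z) \<le> fact 1 * (zeta_const * (5 * R)\<^sup>2) / (1/8) ^ 1"
    proof (rule Cauchy_inequality)
      show "zeta1 holomorphic_on ball z (1/8)"
        using hol ball_subset_cball by (rule holomorphic_on_subset)
      show "continuous_on (cball z (1/8)) zeta1"
        using hol by (rule holomorphic_on_imp_continuous_on)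
      fix w assume w: "norm (z - w) = 1/8"
      then have "norm (zeta1 w) \<le> zeta_const * (1 + norm w)\<^sup>2"
        using near[of w] by (intro zeta1_bound) auto
      also have "(1 + norm w)\<^sup>2 \<le> (5 * R)\<^sup>2"
        using near[of w] w R by (intro power_mono) auto
      finally show "norm (zeta1 w) \<le> zeta_const * (5 * R)\<^sup>2"
        using zeta_const_ge_1 by (auto simp: mult_left_mono)
    qed simp
    then have "norm (deriv zeta1 z) \<le> 200 * (zeta_const * R\<^sup>2)" by (simp add: power_mult_distrib)
    also have "\<dots> \<le> 512 * (zeta_const * R\<^sup>2)"
      using zeta_const_ge_1 by (intro mult_right_mono) auto
    finally show "norm (deriv zeta1 z) \<le> 512 * zeta_const * R\<^sup>2" by simp
  qed (use assms in \<open>auto simp: S_def\<close>)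
qed

text \<open>The 3-4-1 inequality is solved for the factor at \<sigma> + it. Writing \<sigma> - 1 as
  a fourth power makes the fourth root rational in \<eta>. The bound is uniform in t because |t|^5
  outweighs the quadratic growth of \<open>zeta1\<close> at \<sigma> + 2it; t0 keeps t away from 0,
  where |t|^5 degenerates.\<close>

lemma zeta1_lower_bound_right:
  assumes t0: "0 < t0" "t0 \<le> 1" and t: "t0 \<le> \<bar>t\<bar>" and \<eta>: "0 < \<eta>" "\<eta> \<le> 1"
  shows "(t0 / 2) ^ 5 / (9 * zeta_const) ^ 4 * \<eta> ^ 3 \<le> norm (zeta1 (Complex (1 + \<eta> ^ 4) t))"
proof -
  define \<sigma> where "\<sigma> = 1 + \<eta> ^ 4"
  define c where "c = (t0 / 2) ^ 5 / (9 * zeta_const) ^ 4"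
  define \<tau> where "\<tau> = 1 + \<bar>t\<bar>"
  define z where "z = norm (zeta1 (Complex \<sigma> t))"
  have K: "zeta_const \<ge> 1" by (rule zeta_const_ge_1)
  have \<sigma>: "1 < \<sigma>" "\<sigma> \<le> 2" using \<eta> by (auto simp: \<sigma>_def power_le_one)
  have \<tau>: "\<tau> \<ge> 1" by (simp add: \<tau>_def)
  have "norm (zeta1 (of_real \<sigma>)) \<le> zeta_const * (1 + norm (of_real \<sigma> :: complex))\<^sup>2"
    using \<sigma> by (intro zeta1_bound) auto
  also have "(1 + norm (of_real \<sigma> :: complex))\<^sup>2 \<le> 3\<^sup>2"
    using \<sigma> by (intro power_mono) auto
  finally have b0: "norm (zeta1 (of_real \<sigma>)) \<le> 9 * zeta_const" using K by (auto simp: mult_left_mono)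
  have "norm (zeta1 (Complex \<sigma> (2 * t))) \<le> zeta_const * (1 + norm (Complex \<sigma> (2 * t)))\<^sup>2"
    using \<sigma> by (intro zeta1_bound) auto
  also have "(1 + norm (Complex \<sigma> (2 * t)))\<^sup>2 \<le> (3 * \<tau>)\<^sup>2"
    using \<sigma> norm_le_strip[of "Complex \<sigma> (2 * t)" 2 "2 * \<bar>t\<bar>"] by (intro power_mono) (auto simp: \<tau>_def abs_mult)
  finally have b2: "norm (zeta1 (Complex \<sigma> (2 * t))) \<le> 9 * zeta_const * \<tau>\<^sup>2"
    using K by (simp add: power_mult_distrib mult_left_mono)
  have "t0 / 2 * \<tau> \<le> \<bar>t\<bar>"
  proof (cases "\<bar>t\<bar> \<ge> 1")
    case True
    have "t0 / 2 * \<tau> \<le> 1 / 2 * \<tau>" using t0 \<tau> by (intro mult_right_mono) auto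
    also have "\<dots> \<le> \<bar>t\<bar>" using True by (simp add: \<tau>_def)
    finally show ?thesis .
  next
    case False
    have "t0 / 2 * \<tau> \<le> t0 / 2 * 2" using t0 False by (intro mult_left_mono) (auto simp: \<tau>_def)
    with t show ?thesis by simp
  qed
  then have "(t0 / 2 * \<tau>) ^ 5 \<le> \<bar>t\<bar> ^ 5" using t0 \<tau> by (intro power_mono) auto
  moreover have "(t0 / 2) ^ 5 * \<tau>\<^sup>2 \<le> (t0 / 2) ^ 5 * \<tau> ^ 5"
    using t0 \<tau> by (intro mult_left_mono power_increasing) auto
  ultimately have "(t0 / 2) ^ 5 * \<tau>\<^sup>2 \<le> \<bar>t\<bar> ^ 5" unfolding power_mult_distrib by linarith
  then have "(\<sigma> - 1) ^ 3 * ((t0 / 2) ^ 5 * \<tau>\<^sup>2) \<le> (\<sigma> - 1) ^ 3 * \<bar>t\<bar> ^ 5"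
    using \<sigma> by (intro mult_left_mono) auto
  also have "\<dots> \<le> norm (zeta1 (of_real \<sigma>)) ^ 3 * z ^ 4 * norm (zeta1 (Complex \<sigma> (2 * t)))"
    unfolding z_def by (rule zeta1_three_four_one[OF \<sigma>(1)])
  also have "\<dots> \<le> (9 * zeta_const) ^ 3 * z ^ 4 * (9 * zeta_const * \<tau>\<^sup>2)"
    using K by (intro mult_mono power_mono b0 b2) (auto simp: z_def)
  finally have "((\<sigma> - 1) ^ 3 * (t0 / 2) ^ 5) * \<tau>\<^sup>2 \<le> (9 * zeta_const) ^ 4 * z ^ 4 * \<tau>\<^sup>2"
    by (simp add: power_numeral_reduce mult_ac)
  then have "(\<sigma> - 1) ^ 3 * (t0 / 2) ^ 5 \<le> (9 * zeta_const) ^ 4 * z ^ 4"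
    using \<tau> by (simp add: mult_le_cancel_right)
  then have z4: "(\<sigma> - 1) ^ 3 * c \<le> z ^ 4"
    using K by (simp add: c_def field_simps)
  have "(t0 / 2) ^ 5 \<le> 1" using t0 by (intro power_le_one) auto
  moreover have "(9 * zeta_const) ^ 4 \<ge> 1" using K by (intro one_le_power) auto
  ultimately have c: "0 < c" "c \<le> 1" using t0 K by (auto simp: c_def)
  have "(c * \<eta> ^ 3) ^ 4 = (\<sigma> - 1) ^ 3 * c ^ 4"
    by (simp add: \<sigma>_def power_mult_distrib flip: power_mult)
  \<comment> \<open>As c \<le> 1, it can stand in for its own fourth root.\<close>
  also have "c ^ 4 \<le> c ^ 1" using c by (intro power_decreasing) auto
  then have "(\<sigma> - 1) ^ 3 * c ^ 4 \<le> (\<sigma> - 1) ^ 3 * c" using \<sigma> by (intro mult_left_mono) auto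
  also note z4
  finally have "c * \<eta> ^ 3 \<le> z" by (rule power_le_imp_le_base[of _ 3, simplified]) (simp add: z_def)
  then show ?thesis by (simp add: c_def z_def \<sigma>_def)
qed

text \<open>The gain \<eta>^3 must dominate the loss R^2 \<eta>^4, so \<eta> is a small multiple of
  R^(-2). Hence the width \<eta>^4 is of order R^(-8) and the bound \<eta>^3 of order
  R^(-6).\<close>

lemma zeta1_lower_bound:
  obtains c where "0 < c" "c \<le> 1/4"
    "\<And>R s. R \<ge> 1 \<Longrightarrow> \<bar>Im s\<bar> \<le> R \<Longrightarrow> 1 - c / R ^ 8 \<le> Re s \<Longrightarrow> Re s \<le> 1 \<Longrightarrow> c / R ^ 6 \<le> norm (zeta1 s)"
proof -
  \<comment> \<open>Both choices equalise a Lipschitz loss with half of what is available: 512 *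
    \<open>zeta_const\<close> * 2 * t0 = 1/2 near the point 1, and 1024 * \<open>zeta_const\<close>
    * k = c1/2 elsewhere.\<close>
  define t0 where "t0 = 1 / (2048 * zeta_const)"
  define c1 where "c1 = (t0 / 2) ^ 5 / (9 * zeta_const) ^ 4"
  define k where "k = c1 * t0"
  have K: "zeta_const \<ge> 1" by (rule zeta_const_ge_1)
  have t0: "0 < t0" "t0 \<le> 1/4" using K by (auto simp: t0_def field_simps)
  have "(t0 / 2) ^ 5 \<le> 1" using t0 by (intro power_le_one) auto
  moreover have "(9 * zeta_const) ^ 4 \<ge> 1" using K by (intro one_le_power) auto
  ultimately have c1: "0 < c1" "c1 \<le> 1" using t0 K by (auto simp: c1_def)
  have k: "0 < k" "k \<le> c1 / 4" "k \<le> t0"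
    using c1 t0 mult_left_mono[OF t0(2), of c1] mult_right_mono[OF c1(2), of t0] by (auto simp: k_def)
  then have k14: "k \<le> 1/4" using t0 by simp
  note k = k k14
  have "k ^ 4 \<le> k ^ 1" using k by (intro power_decreasing) auto
  then have k4: "k ^ 4 \<le> k" by simp
  have main: "k ^ 4 / R ^ 6 \<le> norm (zeta1 s)"
    if R: "R \<ge> 1" and s: "\<bar>Im s\<bar> \<le> R" "1 - k ^ 4 / R ^ 8 \<le> Re s" "Re s \<le> 1" for R s
  proof -
    \<comment> \<open>To the right of 1, at distance \<open>\<eta>\<^sup>4\<close>, the 3-4-1 inequality bounds \<open>\<bar>zeta1\<bar>\<close> below by a multiple of
      \<open>\<eta>\<^sup>3\<close>; moving left by \<open>2\<eta>\<^sup>4\<close> loses only \<open>O(R\<^sup>2 \<eta>\<^sup>4)\<close>.\<close>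
    define \<eta> where "\<eta> = k / R\<^sup>2"
    have "R\<^sup>2 \<ge> 1" using R by (simp add: one_le_power)
    moreover have "R\<^sup>2 > 0" using R by simp
    ultimately have \<eta>: "0 < \<eta>" "\<eta> \<le> k"
      using k(1) by (simp_all add: \<eta>_def divide_le_eq mult_le_cancel_left1 del: zero_less_power2)
    have \<eta>4: "\<eta> ^ 4 = k ^ 4 / R ^ 8" by (simp add: \<eta>_def power_divide flip: power_mult)
    have \<eta>3: "\<eta> ^ 3 = k ^ 3 / R ^ 6" by (simp add: \<eta>_def power_divide flip: power_mult)
    have "\<eta> ^ 4 \<le> \<eta> ^ 1" using k \<eta> by (intro power_decreasing) auto
    then have \<eta>41: "\<eta> ^ 4 \<le> \<eta>" by simp
    have Re: "3/4 \<le> Re s" "1 - \<eta> ^ 4 \<le> Re s" using s \<eta>41 \<eta> k by (auto simp: \<eta>4)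
    have low: "k ^ 4 / R ^ 6 \<le> c1 / 2 * \<eta> ^ 3"
    proof -
      have "k ^ 4 = k * k ^ 3" by (simp add: power_numeral_reduce)
      also have "\<dots> \<le> c1 / 2 * k ^ 3" using k c1 by (intro mult_right_mono) auto
      finally have "k ^ 4 / R ^ 6 \<le> (c1 / 2 * k ^ 3) / R ^ 6"
        using R by (intro divide_right_mono) auto
      then show ?thesis by (simp add: \<eta>3)
    qed
    show ?thesis
    proof (cases "\<bar>Im s\<bar> \<le> t0")
      \<comment> \<open>Close to the real axis the 3-4-1 bound is too weak; here the value 1 of
        \<open>zeta1\<close> at 1 is carried over by the Lipschitz bound.\<close>
      case True
      have "norm (zeta1 s - zeta1 1) \<le> 512 * zeta_const * 1\<^sup>2 * norm (s - 1)"
        using True t0 Re s by (intro zeta1_lipschitz) auto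
      also have "norm (s - 1) \<le> t0 + t0"
        using cmod_le[of "s - 1"] True Re s \<eta>41 \<eta> k by auto
      finally have "norm (zeta1 s - 1) \<le> 1/2"
        using K by (simp add: zeta1_1 t0_def)
      then have "norm (zeta1 s) \<ge> 1/2"
        using norm_triangle_ineq3[of "zeta1 s" 1] by simp
      moreover have "c1 / 2 * \<eta> ^ 3 \<le> 1/2 * 1"
        using c1 \<eta> k by (intro mult_mono power_le_one) auto
      ultimately show ?thesis using low by linarith
    next
      case False
      define s' where "s' = Complex (1 + \<eta> ^ 4) (Im s)"
      have "c1 * \<eta> ^ 3 \<le> norm (zeta1 s')"
        unfolding c1_def s'_def using False t0 \<eta> k by (intro zeta1_lower_bound_right) auto
      moreover have "norm (zeta1 s' - zeta1 s) \<le> c1 / 2 * \<eta> ^ 3"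
      proof -
        have "norm (zeta1 s' - zeta1 s) \<le> 512 * zeta_const * R\<^sup>2 * norm (s' - s)"
          using R s Re \<eta>41 \<eta> k by (intro zeta1_lipschitz) (auto simp: s'_def)
        also have "s' - s = of_real (1 + \<eta> ^ 4 - Re s)" by (simp add: s'_def complex_eq_iff)
        then have "norm (s' - s) \<le> 2 * \<eta> ^ 4" using Re s \<eta> by (simp only: norm_of_real)
        then have "512 * zeta_const * R\<^sup>2 * norm (s' - s) \<le> 512 * zeta_const * R\<^sup>2 * (2 * \<eta> ^ 4)"
          using K by (intro mult_left_mono) auto
        also have "\<dots> = (1024 * zeta_const * R\<^sup>2 * \<eta>) * \<eta> ^ 3" by (simp add: power_numeral_reduce)
        also have "1024 * zeta_const * R\<^sup>2 * \<eta> = c1 / 2"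
          using R K by (simp add: \<eta>_def k_def t0_def)
        finally show ?thesis .
      qed
      moreover have "norm (zeta1 s') \<le> norm (zeta1 s' - zeta1 s) + norm (zeta1 s)"
        using norm_triangle_sub by (metis add.commute)
      ultimately have "c1 * \<eta> ^ 3 \<le> c1 / 2 * \<eta> ^ 3 + norm (zeta1 s)" by linarith
      then have "c1 / 2 * \<eta> ^ 3 \<le> norm (zeta1 s)" by simp
      with low show ?thesis by linarith
    qed
  qed
  show thesis
    by (rule that[of "k ^ 4"]) (use k k4 main in auto)
qed

section \<open>Newman's contour argument\<close>

definition moebius_partial :: "nat \<Rightarrow> complex \<Rightarrow> complex" where
  "moebius_partial N w = (\<Sum>n=1..N. of_int (moebius n) * of_nat n powr (-(1 + w)))"

lemma moebius_partial_0: "moebius_partial N 0 = of_real (mert {} N)"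
proof -
  have "rough {} \<inter> {..N} = {1..N}" by (auto simp: rough_def)
  then show ?thesis
    by (auto simp: moebius_partial_def mert_def powr_minus_divide intro!: sum.cong)
qed

section \<open>Bounds for the tail and the partial sums of the Moebius series\<close>

lemma powr_telescope_neg:
  assumes "m > 0" "x > 0"
  shows "real (Suc m) powr (- x - 1) \<le> (real m powr (-x) - real (Suc m) powr (-x)) / x"
proof -
  have "\<exists>z>real m. z < real (Suc m) \<and> (- (real (Suc m) powr (-x)) / x) - (- (real m powr (-x)) / x) =
      (real (Suc m) - real m) * z powr (- x - 1)"
    by (rule MVT2) (use assms in \<open>auto intro!: derivative_eq_intros simp: field_simps\<close>)
  then obtain z where z: "real m < z" "z < real (Suc m)"
    "(real m powr (-x) - real (Suc m) powr (-x)) / x = z powr (- x - 1)"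
    by (auto simp: diff_divide_distrib)
  have "real (Suc m) powr (- x - 1) \<le> z powr (- x - 1)"
    using z assms by (intro powr_mono2') auto
  with z show ?thesis by simp
qed

text \<open>The exponent a - 1 may have either sign. The power is compared with the increment over
  [n, n + 1] if it increases and over [n - 1, n] if it decreases; the difference over two steps
  covers both cases and still telescopes.\<close>

lemma powr_telescope_pos:
  assumes "n > 0" "a > 0"
  shows "real n powr (a - 1) \<le> (real (Suc n) powr a - real (n - 1) powr a) / a"
proof -
  have mono: "real (n - 1) powr a \<le> real n powr a" "real n powr a \<le> real (Suc n) powr a"
    using assms by (auto intro!: powr_mono2)
  have mvt: "\<exists>z. u < z \<and> z < v \<and> (v powr a - u powr a) / a = (v - u) * z powr (a - 1)"
    if "0 < u" "u < v" for u v
  proof -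
    have "\<exists>z>u. z < v \<and> v powr a / a - u powr a / a = (v - u) * z powr (a - 1)"
      by (rule MVT2) (use assms that in \<open>auto intro!: derivative_eq_intros simp: field_simps\<close>)
    then show ?thesis by (auto simp: diff_divide_distrib)
  qed
  show ?thesis
  proof (cases "a \<ge> 1")
    case True
    obtain z where z: "real n < z" "(real (Suc n) powr a - real n powr a) / a = z powr (a - 1)"
      using mvt[of "real n" "real (Suc n)"] assms by auto
    have "real n powr (a - 1) \<le> z powr (a - 1)" using z True by (intro powr_mono2) auto
    also have "\<dots> \<le> (real (Suc n) powr a - real (n - 1) powr a) / a"
      unfolding z(2) [symmetric] using mono assms by (intro divide_right_mono) auto
    finally show ?thesis .
  next
    case False
    have "real n powr (a - 1) \<le> (real n powr a - real (n - 1) powr a) / a"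
    \<comment> \<open>The mean value theorem is applied away from 0; at n = 1 the claim is just 1
      \<le> 1/a.\<close>
    proof (cases "n = 1")
      case True
      then show ?thesis using assms False by simp
    next
      case n: False
      then obtain z where z: "real (n - 1) < z" "z < real n"
        "(real n powr a - real (n - 1) powr a) / a = (real n - real (n - 1)) * z powr (a - 1)"
        using mvt[of "real (n - 1)" "real n"] assms by auto
      have "real n powr (a - 1) \<le> z powr (a - 1)" using z False n assms by (intro powr_mono2') auto
      then show ?thesis using z(3) assms by (simp add: of_nat_diff)
    qed
    also have "\<dots> \<le> (real (Suc n) powr a - real (n - 1) powr a) / a"
      using mono assms by (intro divide_right_mono) auto
    finally show ?thesis .
  qed
qed

lemma norm_moebius_powr_le:
  "norm (of_int (moebius n) * of_nat n powr (-(1 + w)) :: complex) \<le> real n powr (- Re w - 1)"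
proof -
  have "norm (of_int (moebius n) * of_nat n powr (-(1 + w)) :: complex) \<le> 1 * real n powr (Re (-(1 + w)))"
    unfolding norm_mult using norm_of_int_moebius_le[of n]
    by (intro mult_mono) (auto simp: norm_powr_real_powr)
  moreover have "Re (-(1 + w)) = - Re w - 1" by simp
  ultimately show ?thesis by (simp only: mult_1)
qed

lemma moebius_tail_bound:
  assumes "Re w > 0" "N > 0"
  shows "norm (moebius_rough {} (1 + w) - moebius_partial N w) \<le> real N powr (- Re w) / Re w"
proof -
  define x where "x = Re w"
  let ?f = "\<lambda>n. of_int (moebius n) * of_nat n powr (-(1 + w)) :: complex"
  have x: "x > 0" using assms by (simp add: x_def)
  have "Re (1 + w) > 1" using assms by simp
  from abs_summable_dirichlet_powr[OF this, of "\<lambda>n. of_int (moebius n)" UNIV, OF norm_of_int_moebius_le]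
  have "?f summable_on UNIV" by (rule abs_summable_summable)
  then have "?f sums infsum ?f UNIV" by (intro has_sum_imp_sums) auto
  moreover have "infsum ?f UNIV = moebius_rough {} (1 + w)"
    unfolding moebius_rough_def by (rule infsum_cong_neutral) (auto simp: rough_def)
  ultimately have S: "?f sums moebius_rough {} (1 + w)" by simp
  have P: "(\<Sum>n<Suc N. ?f n) = moebius_partial N w"
    unfolding moebius_partial_def
    by (rule sum.mono_neutral_right) (auto simp: not_le)
  have tail: "(\<lambda>n. ?f (n + Suc N)) sums (moebius_rough {} (1 + w) - moebius_partial N w)"
    unfolding P [symmetric] by (rule sums_split_initial_segment[OF S])
  have "(\<lambda>n. real (n + N) powr (-x)) \<longlonglongrightarrow> 0" using x by real_asymp
  from sums_divide[OF telescope_sums'[OF this], of x]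
  have T: "(\<lambda>n. (real (n + N) powr (-x) - real (Suc (n + N)) powr (-x)) / x) sums (real N powr (-x) / x)"
    by simp
  have le: "norm (?f (n + Suc N)) \<le> (real (n + N) powr (-x) - real (Suc (n + N)) powr (-x)) / x" for n
  proof -
    have "norm (?f (n + Suc N)) \<le> real (n + Suc N) powr (- x - 1)"
      using norm_moebius_powr_le[of "n + Suc N" w] by (simp only: x_def)
    also have "\<dots> = real (Suc (n + N)) powr (- x - 1)" by simp
    also have "\<dots> \<le> (real (n + N) powr (-x) - real (Suc (n + N)) powr (-x)) / x"
      by (rule powr_telescope_neg) (use assms x in auto)
    finally show ?thesis .
  qed
  have "norm (moebius_rough {} (1 + w) - moebius_partial N w) = norm (suminf (\<lambda>n. ?f (n + Suc N)))"
    using tail by (simp add: sums_iff)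
  also have "\<dots> \<le> (\<Sum>n. (real (n + N) powr (-x) - real (Suc (n + N)) powr (-x)) / x)"
    by (rule norm_suminf_le[OF le]) (use T in \<open>simp add: sums_iff\<close>)
  also have "\<dots> = real N powr (-x) / x" using T by (simp add: sums_iff)
  finally show ?thesis by (simp add: x_def)
qed

text \<open>With a = -Re w the comparison sum of n^(a-1) telescopes to ((N+1)^a + N^a)/a. Since a
  \<le> N, (N+1)^a is at most e N^a \<le> 3 N^a. This is what later restricts the radius to R \<le>
  N.\<close>

lemma moebius_partial_bound:
  assumes "Re w < 0" "- Re w \<le> real N" "N > 0"
  shows "norm (moebius_partial N w) \<le> 6 * real N powr (- Re w) / (- Re w)"
proof -
  define a where "a = - Re w"
  have a: "0 < a" "a \<le> real N" using assms by (auto simp: a_def)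
  have tel: "(\<Sum>n=1..N. real (Suc n) powr a - real (n - 1) powr a) \<le> real (Suc N) powr a + real N powr a" for N
    using a by (induction N) auto
  have "norm (moebius_partial N w) \<le> (\<Sum>n=1..N. real n powr (a - 1))"
    unfolding moebius_partial_def
    using norm_moebius_powr_le[of _ w] by (intro sum_norm_le) (simp only: a_def)
  also have "\<dots> \<le> (\<Sum>n=1..N. (real (Suc n) powr a - real (n - 1) powr a) / a)"
    by (intro sum_mono powr_telescope_pos) (use a in auto)
  also have "\<dots> \<le> (real (Suc N) powr a + real N powr a) / a"
    using tel a by (simp add: divide_right_mono flip: sum_divide_distrib)
  finally have *: "norm (moebius_partial N w) \<le> (real (Suc N) powr a + real N powr a) / a" .
  have "real N powr a \<le> real (Suc N) powr a" using a by (intro powr_mono2) auto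
  moreover have "real (Suc N) powr a \<le> 3 * real N powr a"
  proof -
    have "ln (real (Suc N)) - ln (real N) \<le> 1 / real N"
      using ln_diff_le[of "real (Suc N)" "real N"] assms by simp
    then have "a * (ln (real (Suc N)) - ln (real N)) \<le> a * (1 / real N)"
      using a by (intro mult_left_mono) auto
    also have "\<dots> \<le> 1" using a assms by (simp add: field_simps)
    finally have "a * ln (real (Suc N)) \<le> 1 + a * ln (real N)" by (simp add: algebra_simps)
    then have "exp (a * ln (real (Suc N))) \<le> exp 1 * exp (a * ln (real N))"
      by (simp flip: exp_add)
    also have "\<dots> \<le> 3 * exp (a * ln (real N))" using exp_le by (intro mult_right_mono) auto
    finally show ?thesis using assms by (simp add: powr_def)
  qed
  ultimately have "real (Suc N) powr a + real N powr a \<le> 6 * real N powr a" by linarith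
  then have "(real (Suc N) powr a + real N powr a) / a \<le> (6 * real N powr a) / a"
    using a by (intro divide_right_mono) auto
  with * show ?thesis by (simp only: a_def)
qed

text \<open>
  On the circle, Newman's kernel contributes a factor \<open>\<bar>Re w\<bar>\<close> that cancels the pole \<open>1 / \<bar>Re w\<bar>\<close> in
  the bounds for the tail (right half) and for the partial sum (left half).
\<close>

lemma norm_newman_kernel:
  assumes "norm w = R" "R > 0"
  shows "norm ((1 + w\<^sup>2 / of_real (R\<^sup>2)) / w) = 2 * \<bar>Re w\<bar> / R\<^sup>2"
proof -
  have "w \<noteq> 0" using assms by auto
  have "w * cnj w = of_real (R\<^sup>2)" using assms complex_norm_square[of w] by simp
  then have "(1 + w\<^sup>2 / of_real (R\<^sup>2)) / w = (cnj w + w) / of_real (R\<^sup>2)"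
    using \<open>w \<noteq> 0\<close> assms by (simp add: field_simps power2_eq_square)
  also have "cnj w + w = of_real (2 * Re w)" by (simp add: complex_eq_iff)
  also have "of_real (2 * Re w) / of_real (R\<^sup>2) = (of_real (2 * Re w / R\<^sup>2) :: complex)" by simp
  finally show ?thesis using assms by (simp only: norm_of_real) (simp add: abs_mult)
qed

section \<open>Newman's contour integral on a circle of radius R\<close>

lemma contour_integral_part_circlepath_split:
  assumes "a < b" "b < c" "continuous_on (sphere z r) f" "r \<ge> 0"
  shows "contour_integral (part_circlepath z r a c) f
       = contour_integral (part_circlepath z r a b) f + contour_integral (part_circlepath z r b c) f"
proof -
  let ?g = "\<lambda>t. f (z + of_real r * cis t) * of_real r * \<i> * cis t"
  have "continuous_on {a..c} ?g"
    by (intro continuous_intros continuous_on_compose2[OF assms(3)])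
       (use assms(4) in \<open>auto simp: dist_norm norm_mult\<close>)
  then have "?g integrable_on {a..c}" by (rule integrable_continuous_real)
  then have "integral {a..b} ?g + integral {b..c} ?g = integral {a..c} ?g"
    using assms by (intro Henstock_Kurzweil_Integration.integral_combine) auto
  then show ?thesis using assms by (simp add: contour_integral_part_circlepath_eq)
qed

text \<open>The tail bound has the factor 1/Re w, so the formula for \<open>h\<close> is used only
  where Re w > 0; the points \<plusminus>iR form a finite exceptional set that the integral estimate
  ignores. Elsewhere the powers of N and the factors Re w cancel, leaving 2/R^2.\<close>

lemma newman_right_arc:
  assumes RN: "R \<ge> 1" "N > 0" and ab: "a < b" "\<And>x. a \<le> x \<Longrightarrow> x \<le> b \<Longrightarrow> cos x \<ge> 0"
    and cont: "continuous_on (path_image (part_circlepath 0 R a b)) h"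
    and h: "\<And>w. Re w > 0 \<Longrightarrow> h w = (moebius_rough {} (1 + w) - moebius_partial N w) * of_nat N powr w
      * ((1 + w\<^sup>2 / of_real (R\<^sup>2)) / w)"
  shows "norm (contour_integral (part_circlepath 0 R a b) h) \<le> 2 / R * (b - a)"
proof -
  have "norm (contour_integral (part_circlepath 0 R a b) h) \<le> 2 / R\<^sup>2 * R * (b - a)"
  proof (rule contour_integral_bound_part_circlepath_strong)
    show "h contour_integrable_on part_circlepath 0 R a b"
      by (rule contour_integrable_continuous_part_circlepath[OF cont])
    show "finite {Complex 0 R, Complex 0 (-R)}" by simp
    fix w assume w: "w \<in> path_image (part_circlepath 0 R a b) - {Complex 0 R, Complex 0 (-R)}"
    then obtain x where x: "a \<le> x" "x \<le> b" "w = of_real R * cis x"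
      using ab by (auto simp: path_image_part_circlepath cis_conv_exp)
    have norm: "norm w = R" using x RN by (simp add: norm_mult)
    have "Re w \<ge> 0" using x ab RN by auto
    moreover have "Re w \<noteq> 0"
    proof
      assume 0: "Re w = 0"
      then have "\<bar>Im w\<bar> = R" using norm cmod_eq_Im by metis
      with 0 have "w = Complex 0 R \<or> w = Complex 0 (-R)" by (auto simp: complex_eq_iff)
      with w show False by auto
    qed
    ultimately have pos: "Re w > 0" by simp
    have "norm (h w) = norm (moebius_rough {} (1 + w) - moebius_partial N w) * real N powr (Re w) * (2 * \<bar>Re w\<bar> / R\<^sup>2)"
      unfolding h[OF pos] norm_mult using RN norm_newman_kernel[OF norm] by (simp add: norm_powr_real_powr)
    also have "\<dots> \<le> (real N powr (- Re w) / Re w) * real N powr (Re w) * (2 * \<bar>Re w\<bar> / R\<^sup>2)"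
      using RN by (intro mult_right_mono moebius_tail_bound pos) auto
    also have "\<dots> = 2 / R\<^sup>2"
      using pos RN by (simp add: powr_minus field_simps)
    finally show "norm (h w) \<le> 2 / R\<^sup>2" .
  qed (use RN ab in auto)
  also have "2 / R\<^sup>2 * R = 2 / R" using RN by (simp add: power2_eq_square)
  finally show ?thesis .
qed

lemma newman_left_arc:
  assumes RN: "R \<ge> 1" "R \<le> real N"
    and h: "h = (\<lambda>w. moebius_partial N w * of_nat N powr w * (1 + w\<^sup>2 / of_real (R\<^sup>2)) / w)"
    and cont: "continuous_on (sphere 0 R) h"
  shows "norm (contour_integral (part_circlepath 0 R (pi/2) (3*pi/2)) h) \<le> 12 / R * pi"
proof -
  have N: "N > 0" using RN by (cases N) auto
  have "norm (contour_integral (part_circlepath 0 R (pi/2) (3*pi/2)) h) \<le> 12 / R\<^sup>2 * R * (3*pi/2 - pi/2)"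
  proof (rule contour_integral_bound_part_circlepath_strong)
    show "h contour_integrable_on part_circlepath 0 R (pi/2) (3*pi/2)"
      using RN by (intro contour_integrable_continuous_part_circlepath continuous_on_subset[OF cont]
          path_image_part_circlepath_subset') auto
    show "finite {Complex 0 R, Complex 0 (-R)}" by simp
    fix w assume w: "w \<in> path_image (part_circlepath 0 R (pi/2) (3*pi/2)) - {Complex 0 R, Complex 0 (-R)}"
    then obtain x where x: "pi/2 \<le> x" "x \<le> 3*pi/2" "w = of_real R * cis x"
      by (auto simp: path_image_part_circlepath cis_conv_exp)
    have norm: "norm w = R" using x RN by (simp add: norm_mult)
    have "cos (x - pi) \<ge> 0" using x by (intro cos_ge_zero) auto
    then have "Re w \<le> 0" using x RN by (auto simp: cos_diff intro!: mult_nonneg_nonpos)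
    moreover have "Re w \<noteq> 0"
    proof
      assume 0: "Re w = 0"
      then have "\<bar>Im w\<bar> = R" using norm cmod_eq_Im by metis
      with 0 have "w = Complex 0 R \<or> w = Complex 0 (-R)" by (auto simp: complex_eq_iff)
      with w show False by auto
    qed
    ultimately have neg: "Re w < 0" by simp
    have le: "- Re w \<le> real N" using abs_Re_le_cmod[of w] norm RN by auto
    have "h w = moebius_partial N w * of_nat N powr w * ((1 + w\<^sup>2 / of_real (R\<^sup>2)) / w)"
      by (simp add: h)
    then have "norm (h w) = norm (moebius_partial N w) * norm (of_nat N powr w :: complex)
        * norm ((1 + w\<^sup>2 / of_real (R\<^sup>2)) / w)"
      by (simp only: norm_mult)
    also have "\<dots> = norm (moebius_partial N w) * real N powr (Re w) * (2 * \<bar>Re w\<bar> / R\<^sup>2)"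
      using RN norm_newman_kernel[OF norm] by (simp add: norm_powr_real_powr)
    finally have "norm (h w) = norm (moebius_partial N w) * real N powr (Re w) * (2 * \<bar>Re w\<bar> / R\<^sup>2)" .
    also have "\<dots> \<le> (6 * real N powr (- Re w) / (- Re w)) * real N powr (Re w) * (2 * \<bar>Re w\<bar> / R\<^sup>2)"
      using RN N by (intro mult_right_mono moebius_partial_bound neg le) auto
    also have "\<dots> = 12 / R\<^sup>2"
      using neg RN N by (simp add: powr_minus field_simps)
    finally show "norm (h w) \<le> 12 / R\<^sup>2" .
  qed (use RN in auto)
  also have "12 / R\<^sup>2 * R = 12 / R" using RN by (simp add: power2_eq_square)
  finally show ?thesis by simp
qed

lemma mert_newman_bound:
  obtains C c where "C > 0" "c > 0"
    "\<And>R N. R \<ge> 1 \<Longrightarrow> R \<le> real N \<Longrightarrow> \<bar>mert {} N\<bar> \<le> C / R + C * R ^ 7 * exp (- c * ln (real N) / R ^ 8)"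
proof -
  obtain c where c: "0 < c" "c \<le> 1/4" and
    low: "\<And>R s. R \<ge> 1 \<Longrightarrow> \<bar>Im s\<bar> \<le> R \<Longrightarrow> 1 - c / R ^ 8 \<le> Re s \<Longrightarrow> Re s \<le> 1 \<Longrightarrow> c / R ^ 6 \<le> norm (zeta1 s)"
    using zeta1_lower_bound by blast
  have main: "\<bar>mert {} N\<bar> \<le> (400 / c) / R + (400 / c) * R ^ 7 * exp (- (c / 512) * ln (real N) / R ^ 8)"
    if RN: "R \<ge> 1" "R \<le> real N" for R N
  proof -
    have N: "N > 0" using RN by (cases N) auto
    \<comment> \<open>As 512 = 2 * 2^8, the width 2\<delta> is the one that the lower bound for
      \<open>zeta1\<close> provides at height 2R.\<close>
    define \<delta> where "\<delta> = c / (512 * R ^ 8)"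
    have R8: "R ^ 8 \<ge> 1" using RN by (intro one_le_power)
    have "c / (512 * R ^ 8) \<le> (1/4) / 1" using c R8 by (intro frac_le) linarith+
    then have \<delta>: "0 < \<delta>" "\<delta> \<le> 1/4" using c RN by (auto simp: \<delta>_def)
    have \<delta>2: "2 * \<delta> = c / (2 * R) ^ 8" by (simp add: \<delta>_def power_mult_distrib)
    \<comment> \<open>An open convex region, so that Cauchy's theorem applies directly, with twice
      the depth and height of the contour as a margin.\<close>
    define D where "D = {w. Re w > - 2 * \<delta>} \<inter> ({w. Im w < 2 * R} \<inter> {w. Im w > - 2 * R})"
    have D: "convex D" "open D" unfolding D_def
      by (auto intro!: convex_Int convex_halfspace_Re_gt convex_halfspace_Im_gt convex_halfspace_Im_lt
          open_Int open_halfspace_Re_gt open_halfspace_Im_gt open_halfspace_Im_lt)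
    have lowD: "c / (64 * R ^ 6) \<le> norm (zeta1 (1 + w))" if "w \<in> D" "Re w \<le> 0" for w
    proof -
      have "\<bar>Im (1 + w)\<bar> \<le> 2 * R" "- (2 * \<delta>) < Re w" using that(1) by (auto simp: D_def abs_le_iff)
      moreover from this have "1 - c / (2 * R) ^ 8 \<le> Re (1 + w)" unfolding \<delta>2 [symmetric] by simp
      ultimately have "c / (2 * R) ^ 6 \<le> norm (zeta1 (1 + w))"
        using that RN by (intro low) simp_all
      then show ?thesis by (simp add: power_mult_distrib)
    qed
    have nz: "zeta1 (1 + w) \<noteq> 0" if "w \<in> D" for w
    proof (cases "Re w > 0")
      case True
      then show ?thesis using zeta1_nonzero[of "1 + w"] by simp
    next
      case False
      then have "c / (64 * R ^ 6) \<le> norm (zeta1 (1 + w))" using lowD that by simp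
      moreover have "c / (64 * R ^ 6) > 0" using c RN by simp
      ultimately show ?thesis by auto
    qed
    define k where "k = (\<lambda>w::complex. of_nat N powr w * (1 + w\<^sup>2 / of_real (R\<^sup>2)))"
    \<comment> \<open>Because \<open>zeta1 (1 + w)\<close> is w \<zeta>(1 + w), the factor 1/w of
      Newman's kernel is already contained in \<open>H\<close>.\<close>
    define H where "H = (\<lambda>w. k w / zeta1 (1 + w))"
    define P where "P = (\<lambda>w. moebius_partial N w * of_nat N powr w * (1 + w\<^sup>2 / of_real (R\<^sup>2)))"
    have hol_k: "k holomorphic_on A" for A unfolding k_def using N RN by (intro holomorphic_intros) auto
    have hol_z: "(\<lambda>w. zeta1 (1 + w)) holomorphic_on D"
    proof -
      have "zeta1 \<circ> (\<lambda>w. 1 + w) holomorphic_on D"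
        by (rule holomorphic_on_compose_gen[OF _ zeta1_holomorphic])
           (use \<delta> in \<open>auto intro!: holomorphic_intros simp: D_def\<close>)
      then show ?thesis by (simp add: o_def)
    qed
    have hol_H: "H holomorphic_on D"
      unfolding H_def by (intro holomorphic_on_divide hol_k hol_z nz)
    have hol_P: "P holomorphic_on A" for A
      unfolding P_def moebius_partial_def using N RN by (intro holomorphic_intros) auto
    \<comment> \<open>A circle path starts at angle 0, the middle of the right half; hence the right
      half appears as two quarter arcs.\<close>
    define A1 A2 A3 where "A1 = part_circlepath 0 R 0 (pi/2)" and "A2 = part_circlepath 0 R (pi/2) (3*pi/2)"
      and "A3 = part_circlepath 0 R (3*pi/2) (2*pi)"
    define L1 L2 L3 where "L1 = linepath (Complex 0 R) (Complex (-\<delta>) R)"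
      and "L2 = linepath (Complex (-\<delta>) R) (Complex (-\<delta>) (-R))"
      and "L3 = linepath (Complex (-\<delta>) (-R)) (Complex 0 (-R))"
    let ?I = "contour_integral"
    \<comment> \<open>\<open>Q\<close> is integrated over the full circle. On the right half it is replaced by \<open>H\<close>, which has no
      pole at 0 since \<open>1/\<zeta>(1 + w)\<close> vanishes there, and the arc of \<open>H\<close> is pushed to \<open>Re w = -\<delta>\<close>.\<close>
    have R0: "R > 0" using RN by simp
    have sphere_D: "w \<in> D" if "norm w = R" "Re w \<ge> 0" for w
      using that \<delta> R0 abs_Im_le_cmod[of w] by (auto simp: D_def abs_le_iff)
    have arc1: "\<exists>x. 0 \<le> x \<and> x \<le> pi/2 \<and> w = of_real R * cis x" if "w \<in> path_image A1" for w
      using that by (auto simp: A1_def path_image_part_circlepath cis_conv_exp)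
    have arc3: "\<exists>x. 3*pi/2 \<le> x \<and> x \<le> 2*pi \<and> w = of_real R * cis x" if "w \<in> path_image A3" for w
      using that by (auto simp: A3_def path_image_part_circlepath cis_conv_exp)
    have cos1: "cos x \<ge> 0" if "0 \<le> x" "x \<le> pi/2" for x
      using that by (intro cos_ge_zero) auto
    have cos3: "cos x \<ge> 0" if "3*pi/2 \<le> x" "x \<le> 2*pi" for x
    proof -
      have "cos (x - 2 * pi) \<ge> 0" using that by (intro cos_ge_zero) auto
      then show ?thesis by (simp add: cos_diff)
    qed
    have A1_D: "path_image A1 \<subseteq> D" and A1_S: "path_image A1 \<subseteq> sphere 0 R"
      using arc1 cos1 R0 by (force intro!: sphere_D simp: norm_mult)+
    have A3_D: "path_image A3 \<subseteq> D" and A3_S: "path_image A3 \<subseteq> sphere 0 R"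
      using arc3 cos3 R0 by (force intro!: sphere_D simp: norm_mult)+
    have corner: "Complex 0 R \<in> D" "Complex (-\<delta>) R \<in> D" "Complex (-\<delta>) (-R) \<in> D" "Complex 0 (-R) \<in> D"
      using \<delta> R0 by (auto simp: D_def)
    have L_D: "path_image L1 \<subseteq> D" "path_image L2 \<subseteq> D" "path_image L3 \<subseteq> D"
      unfolding L1_def L2_def L3_def path_image_linepath
      by (intro closed_segment_subset D(1) corner)+
    have pts: "pathstart A1 = of_real R" "pathfinish A1 = Complex 0 R"
      "pathstart A3 = Complex 0 (-R)" "pathfinish A3 = of_real R"
    proof -
      show "pathstart A1 = of_real R" by (simp add: A1_def)
      show "pathfinish A1 = Complex 0 R" by (simp add: A1_def complex_eq_iff Re_exp Im_exp)
      have e: "exp (\<i> * of_real (3*pi/2)) = - \<i>" 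
        unfolding cis_conv_exp [symmetric]
        using cos_3over2_pi sin_3over2_pi by (simp add: complex_eq_iff)
      show "pathstart A3 = Complex 0 (-R)" by (simp only: A3_def pathstart_part_circlepath e) (simp add: complex_eq_iff)
      have e': "exp (\<i> * of_real (2*pi)) = 1" 
        unfolding cis_conv_exp [symmetric] by (simp add: complex_eq_iff)
      show "pathfinish A3 = of_real R" by (simp only: A3_def pathfinish_part_circlepath e') simp
    qed
    define \<gamma> where "\<gamma> = A3 +++ (A1 +++ (L1 +++ (L2 +++ L3)))"
    have vp [simp]: "valid_path A1" "valid_path A3" "valid_path L1" "valid_path L2" "valid_path L3"
      by (simp_all add: A1_def A3_def L1_def L2_def L3_def)
    have Lpts [simp]: "pathstart L1 = Complex 0 R" "pathfinish L1 = Complex (-\<delta>) R"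
      "pathstart L2 = Complex (-\<delta>) R" "pathfinish L2 = Complex (-\<delta>) (-R)"
      "pathstart L3 = Complex (-\<delta>) (-R)" "pathfinish L3 = Complex 0 (-R)"
      by (simp_all add: L1_def L2_def L3_def)
    have "(H has_contour_integral 0) \<gamma>"
    proof (rule Cauchy_theorem_convex_simple[OF hol_H D(1)])
      show "valid_path \<gamma>" by (simp add: \<gamma>_def pts)
      show "path_image \<gamma> \<subseteq> D" using A1_D A3_D L_D by (simp add: \<gamma>_def path_image_join pts)
      show "pathfinish \<gamma> = pathstart \<gamma>" by (simp add: \<gamma>_def pts)
    qed
    moreover have int_D: "H contour_integrable_on g" if "valid_path g" "path_image g \<subseteq> D" for g
      by (rule contour_integrable_holomorphic_simple[OF hol_H D(2) that])
    then have intH: "H contour_integrable_on A1" "H contour_integrable_on A3" "H contour_integrable_on L1"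
      "H contour_integrable_on L2" "H contour_integrable_on L3"
      using A1_D A3_D L_D by auto
    ultimately have sumH: "?I A3 H + (?I A1 H + (?I L1 H + (?I L2 H + ?I L3 H))) = 0"
      unfolding \<gamma>_def by (auto simp: pts contour_integrable_joinI dest!: contour_integral_unique)

    define Q where "Q = (\<lambda>w. P w / w)"
    have contQ: "continuous_on (sphere 0 R) Q"
      unfolding Q_def using R0 
      by (intro continuous_intros holomorphic_on_imp_continuous_on[OF hol_P]) auto
    have "(Q has_contour_integral (2 * of_real pi * \<i> * P 0)) (circlepath 0 R)"
      using Cauchy_integral_circlepath_simple[OF hol_P, of 0 0 R] R0 by (simp add: Q_def)
    then have "?I (circlepath 0 R) Q = 2 * of_real pi * \<i> * P 0" by (rule contour_integral_unique)
    moreover have "?I (circlepath 0 R) Q = ?I A1 Q + (?I A2 Q + ?I A3 Q)"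
    proof -
      have "?I (circlepath 0 R) Q = ?I A1 Q + ?I (part_circlepath 0 R (pi/2) (2*pi)) Q"
        unfolding circlepath_def A1_def
        by (rule contour_integral_part_circlepath_split) (use contQ R0 in auto)
      also have "?I (part_circlepath 0 R (pi/2) (2*pi)) Q = ?I A2 Q + ?I A3 Q"
        unfolding A2_def A3_def
        by (rule contour_integral_part_circlepath_split) (use contQ R0 in auto)
      finally show ?thesis .
    qed
    moreover have "P 0 = of_real (mert {} N)"
      using N by (simp add: P_def moebius_partial_0)
    ultimately have circ: "2 * of_real pi * \<i> * of_real (mert {} N) = ?I A1 Q + (?I A2 Q + ?I A3 Q)"
      by simp

    have diff: "(\<lambda>w. H w - Q w) w = (moebius_rough {} (1 + w) - moebius_partial N w) * of_nat N powr w
      * ((1 + w\<^sup>2 / of_real (R\<^sup>2)) / w)" if "Re w > 0" for w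
    proof -
      have "w \<noteq> 0" using that by auto
      have "zeta1 (1 + w) * moebius_rough {} (1 + w) = w"
        using zeta1_moebius[of "1 + w"] that by simp
      then have "1 / zeta1 (1 + w) = moebius_rough {} (1 + w) / w"
        using zeta1_nonzero[of "1 + w"] that \<open>w \<noteq> 0\<close> by (simp add: field_simps)
      then have "H w = k w * (moebius_rough {} (1 + w) / w)"
        unfolding H_def by (metis times_divide_eq_right mult.right_neutral)
      moreover have "e * x * (m / w) - p * e * x / w = (m - p) * e * (x / w)" for e x m p
        by (simp add: divide_inverse algebra_simps)
      ultimately show ?thesis by (simp only: k_def Q_def P_def)
    qed
    have intQ: "Q contour_integrable_on A1" "Q contour_integrable_on A3"
      unfolding A1_def A3_def
      by (intro contour_integrable_continuous_part_circlepath continuous_on_subset[OF contQ];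
          use A1_S A3_S in \<open>simp add: A1_def A3_def\<close>)+
    have contHQ: "continuous_on (path_image A1) (\<lambda>w. H w - Q w)" "continuous_on (path_image A3) (\<lambda>w. H w - Q w)"
      using A1_D A3_D A1_S A3_S
      by (auto intro!: continuous_intros continuous_on_subset[OF contQ]
          continuous_on_subset[OF holomorphic_on_imp_continuous_on[OF hol_H]])
    have a1: "norm (?I A1 (\<lambda>w. H w - Q w)) \<le> 2 / R * (pi/2)"
      using newman_right_arc[of R N 0 "pi/2" "\<lambda>w. H w - Q w"] RN N cos1 contHQ(1) diff
      by (simp add: A1_def)
    have a3: "norm (?I A3 (\<lambda>w. H w - Q w)) \<le> 2 / R * (pi/2)"
      using newman_right_arc[of R N "3*pi/2" "2*pi" "\<lambda>w. H w - Q w"] RN N cos3 contHQ(2) diff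
      by (simp add: A3_def)
    have a2: "norm (?I A2 Q) \<le> 12 / R * pi"
      unfolding A2_def by (rule newman_left_arc[OF RN _ contQ]) (simp add: Q_def P_def)

    \<comment> \<open>320 = 5 * 64: the kernel factor is at most 1 + (2R)^2/R^2 = 5, and
      1/|\<open>zeta1\<close>| is at most 64 R^6/c.\<close>
    define B where "B = 320 * R ^ 6 / c"
    have B: "B > 0" using c R0 by (simp add: B_def)
    have normH: "norm (H w) \<le> B * real N powr (Re w)" if w: "w \<in> D" "-\<delta> \<le> Re w" "Re w \<le> 0" "\<bar>Im w\<bar> \<le> R" for w
    proof -
      have "norm w \<le> 2 * R" using cmod_le[of w] w \<delta> RN by auto
      then have "norm w ^ 2 \<le> (2 * R) ^ 2" by (intro power_mono) auto
      then have "norm (w\<^sup>2 / of_real (R\<^sup>2)) \<le> 4"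
        using R0 by (simp add: norm_divide norm_power power_mult_distrib divide_le_eq)
      then have 5: "norm (1 + w\<^sup>2 / of_real (R\<^sup>2)) \<le> 5"
        using norm_triangle_ineq[of 1 "w\<^sup>2 / of_real (R\<^sup>2)"] by simp
      have "norm (H w) = real N powr (Re w) * norm (1 + w\<^sup>2 / of_real (R\<^sup>2)) / norm (zeta1 (1 + w))"
        using N by (simp add: H_def k_def norm_divide norm_mult norm_powr_real_powr)
      also have "\<dots> \<le> real N powr (Re w) * 5 / (c / (64 * R ^ 6))"
        by (intro frac_le mult_left_mono 5 lowD w) (use c R0 in auto)
      also have "\<dots> = B * real N powr (Re w)" using c R0 by (simp add: B_def)
      finally show ?thesis .
    qed
    have segIm: "Re w = -\<delta>" "\<bar>Im w\<bar> \<le> R" if "w \<in> path_image L2" for w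
    proof -
      have "w \<in> closed_segment (Complex (-\<delta>) R) (Complex (-\<delta>) (-R))"
        using that by (simp add: L2_def)
      then have "Re w = -\<delta> \<and> Im w \<in> closed_segment R (-R)"
        by (simp add: closed_segment_same_Re)
      then show "Re w = -\<delta>" "\<bar>Im w\<bar> \<le> R"
        using R0 by (auto simp: closed_segment_eq_real_ivl split: if_splits)
    qed
    have segRe: "-\<delta> \<le> Re w" "Re w \<le> 0" "\<bar>Im w\<bar> \<le> R" if "w \<in> path_image L1 \<union> path_image L3" for w
    proof -
      have "w \<in> closed_segment (Complex 0 R) (Complex (-\<delta>) R) \<or> w \<in> closed_segment (Complex (-\<delta>) (-R)) (Complex 0 (-R))"
        using that by (simp add: L1_def L3_def)
      then have "Re w \<in> closed_segment 0 (-\<delta>) \<and> \<bar>Im w\<bar> = R"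
        using R0 by (auto simp: closed_segment_same_Im closed_segment_commute)
      then show "-\<delta> \<le> Re w" "Re w \<le> 0" "\<bar>Im w\<bar> \<le> R"
        using \<delta> by (auto simp: closed_segment_eq_real_ivl split: if_splits)
    qed
    have Hle: "norm (H w) \<le> B" if "w \<in> path_image L1 \<union> path_image L3" for w
    proof -
      have "norm (H w) \<le> B * real N powr (Re w)"
        using that L_D segRe[OF that] by (intro normH) auto
      also have "real N powr (Re w) \<le> real N powr 0"
        using segRe[OF that] N by (intro powr_mono) auto
      finally show ?thesis using B N by (simp add: mult_left_mono)
    qed
    have l1: "norm (?I L1 H) \<le> B * \<delta>"
      using contour_integral_bound_linepath[of H "Complex 0 R" "Complex (-\<delta>) R" B] intH(3) Hle B \<delta>
      by (simp add: L1_def cmod_def)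
    have l3: "norm (?I L3 H) \<le> B * \<delta>"
      using contour_integral_bound_linepath[of H "Complex (-\<delta>) (-R)" "Complex 0 (-R)" B] intH(5) Hle B \<delta>
      by (simp add: L3_def cmod_def)
    have l2: "norm (?I L2 H) \<le> (B * real N powr (-\<delta>)) * (2 * R)"
    proof -
      have "norm (H w) \<le> B * real N powr (-\<delta>)" if "w \<in> path_image L2" for w
        using normH[of w] segIm[OF that] that L_D(2) \<delta> by auto
      then show ?thesis
        using contour_integral_bound_linepath[of H "Complex (-\<delta>) R" "Complex (-\<delta>) (-R)" "B * real N powr (-\<delta>)"]
          intH(4) B R0
        by (simp add: L2_def cmod_def real_sqrt_mult)
    qed
    \<comment> \<open>On the right arcs Q = H - (H - Q), where H - Q carries only the tail of the
      series; by Cauchy's theorem the two arcs of H equal minus the three segments.\<close>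
    have "2 * of_real pi * \<i> * of_real (mert {} N)
        = - ?I A1 (\<lambda>w. H w - Q w) - ?I A3 (\<lambda>w. H w - Q w) + ?I A2 Q - ?I L1 H - ?I L2 H - ?I L3 H"
      unfolding circ using sumH intH intQ by (simp add: contour_integral_diff algebra_simps)
    then have "norm (2 * of_real pi * \<i> * of_real (mert {} N) :: complex)
        \<le> norm (?I A1 (\<lambda>w. H w - Q w)) + norm (?I A3 (\<lambda>w. H w - Q w)) + norm (?I A2 Q)
           + norm (?I L1 H) + norm (?I L2 H) + norm (?I L3 H)"
      by (smt (verit) norm_triangle_ineq norm_triangle_ineq4 norm_minus_cancel)
    also have "\<dots> \<le> 2 / R * (pi/2) + 2 / R * (pi/2) + 12 / R * pi + B * \<delta> + (B * real N powr (-\<delta>)) * (2 * R) + B * \<delta>"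
      using a1 a2 a3 l1 l2 l3 by linarith
    finally have fin: "2 * pi * \<bar>mert {} N\<bar> \<le> 14 * pi / R + 2 * (B * \<delta>) + 2 * (B * R) * real N powr (-\<delta>)"
      by (simp add: norm_mult field_simps)
    \<comment> \<open>The horizontal segments have length \<delta> of order R^(-8), which beats B of
      order R^6. The vertical one has length 2R, whence the R^7, and is paid for by
      N^(-\<delta>).\<close>
    have "B * \<delta> = 320 / 512 / R\<^sup>2"
      using c R0 by (simp add: B_def \<delta>_def field_simps power_numeral_reduce)
    also have "\<dots> \<le> 1 / R" using RN by (simp add: field_simps power2_eq_square)
    finally have Bd: "B * \<delta> \<le> 1 / R" .
    have "real N powr (-\<delta>) = exp (- (c / 512) * ln (real N) / R ^ 8)"
      using N by (simp add: powr_def \<delta>_def)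
    then have BR: "2 * (B * R) * real N powr (-\<delta>) = 640 / c * (R ^ 7 * exp (- (c / 512) * ln (real N) / R ^ 8))"
      by (simp add: B_def power_numeral_reduce)
    define X where "X = R ^ 7 * exp (- (c / 512) * ln (real N) / R ^ 8)"
    have X: "X \<ge> 0" using R0 by (simp add: X_def)
    have "6 * \<bar>mert {} N\<bar> \<le> 2 * pi * \<bar>mert {} N\<bar>" using pi_gt3 by (intro mult_right_mono) auto
    also note fin
    also have "14 * pi / R \<le> 56 / R" using pi_less_4 R0 by (intro divide_right_mono) auto
    finally have "6 * \<bar>mert {} N\<bar> \<le> 58 / R + 640 / c * X"
      using Bd BR unfolding X_def by simp
    moreover have "58 / R \<le> 6 * ((400 / c) / R)"
      using c R0 by (simp add: field_simps)
    moreover have "640 / c * X \<le> 6 * ((400 / c) * X)"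
      using c X by (simp add: field_simps)
    ultimately show ?thesis by (simp add: X_def mult_ac)
  qed
  show thesis
    by (rule that[of "400 / c" "c / 512"]) (use c main in auto)
qed

section \<open>Summation over primes\<close>

abbreviation damp :: "nat \<Rightarrow> real" where
  "damp N \<equiv> (1 + ln (real N)) powr (-1/16)"

lemma mert_log_bound:
  obtains C where "C > 0" "\<And>N. N > 0 \<Longrightarrow> \<bar>mert {} N\<bar> \<le> C * damp N"
proof -
  obtain C c where Cc: "C > 0" "c > 0" and
    B: "\<And>R N. R \<ge> 1 \<Longrightarrow> R \<le> real N \<Longrightarrow> \<bar>mert {} N\<bar> \<le> C / R + C * R ^ 7 * exp (- c * ln (real N) / R ^ 8)"
    using mert_newman_bound by blast
  have main: "\<bar>mert {} N\<bar> \<le> (C + C * (exp c / c)) * damp N" if N: "N > 0" for N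
  proof -
    define L where "L = 1 + ln (real N)"
    \<comment> \<open>\<open>R\<^sup>8 = \<surd>L\<close>, so the exponential in \<open>B\<close> decays like \<open>exp (-c \<surd>L)\<close> and beats \<open>R\<^sup>7\<close>.\<close>
    define R where "R = L powr (1/16)"
    have L: "L \<ge> 1" using N by (simp add: L_def)
    have LN: "L \<le> real N" using ln_le_minus_one[of "real N"] N by (simp add: L_def)
    have R1: "R \<ge> 1" using L by (simp add: R_def ge_one_powr_ge_zero)
    have "R \<le> L powr 1" unfolding R_def using L by (intro powr_mono) auto
    then have RN: "R \<le> real N" using L LN by simp
    have R7: "R ^ 7 = L powr (7/16)" and R8: "R ^ 8 = sqrt L"
      using L by (simp_all add: R_def powr_power powr_half_sqrt)
    have Rinv: "1 / R = L powr (-1/16)"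
      by (simp add: R_def powr_minus_divide flip: minus_divide_left)
    have s: "sqrt L \<ge> 1" using L by simp
    have "ln (real N) / R ^ 8 = (sqrt L * sqrt L - 1) / sqrt L"
      using L by (simp add: R8 L_def)
    also have "\<dots> = sqrt L - 1 / sqrt L" using L by (simp add: diff_divide_distrib real_div_sqrt)
    also have "\<dots> \<ge> sqrt L - 1" using s by simp
    finally have "c * (sqrt L - 1) \<le> c * (ln (real N) / R ^ 8)" using Cc by (intro mult_left_mono) auto
    then have "exp (- c * ln (real N) / R ^ 8) \<le> exp (c - c * sqrt L)" by (simp add: algebra_simps)
    also have "\<dots> = exp c / exp (c * sqrt L)" by (rule exp_diff)
    \<comment> \<open>The bound exp y \<ge> y is enough: R^7 / sqrt L = L^(7/16 - 8/16) is exactly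
      the size of 1/R.\<close>
    also have "\<dots> \<le> exp c / (c * sqrt L)"
    proof -
      have "c * sqrt L \<le> exp (c * sqrt L)" using exp_ge_add_one_self[of "c * sqrt L"] by linarith
      moreover have "c * sqrt L > 0" using Cc L by simp
      ultimately show ?thesis by (intro divide_left_mono) auto
    qed
    finally have "R ^ 7 * exp (- c * ln (real N) / R ^ 8) \<le> R ^ 7 * (exp c / (c * sqrt L))"
      using R1 by (intro mult_left_mono) auto
    also have "\<dots> = exp c / c * (L powr (7/16) / L powr (1/2))" using L by (simp add: R7 powr_half_sqrt)
    also have "L powr (7/16) / L powr (1/2) = L powr (-1/16)" by (simp flip: powr_diff)
    finally have "C * (R ^ 7 * exp (- c * ln (real N) / R ^ 8)) \<le> C * (exp c / c * L powr (-1/16))"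
      using Cc by (intro mult_left_mono) auto
    moreover have "C / R = C * L powr (-1/16)" using Rinv by (metis times_divide_eq_right mult.right_neutral)
    ultimately show ?thesis using B[OF R1 RN] by (simp add: L_def algebra_simps)
  qed
  show thesis by (rule that[OF _ main]) (use Cc in \<open>auto intro!: add_pos_pos\<close>)
qed

section \<open>Transfer of the saving to sums free of finitely many primes\<close>

text \<open>Passing from N to \<open>N div q\<close> enlarges \<open>damp\<close> far less than the
  division by q \<ge> 2 shrinks it. The ratio 3/4 < 1 is the same for all q, which makes the
  recursion of \<open>mert_split\<close> a uniform contraction.\<close>

lemma damp_div_le:
  assumes "q \<ge> 2" "N div q > 0"
  shows "damp (N div q) / real q \<le> 3/4 * damp N"
proof -
  define M where "M = N div q"
  have M: "M \<ge> 1" using assms by (simp add: M_def)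
  have "N < q * (M + 1)" using assms unfolding M_def
    by (metis Suc_eq_plus1 dividend_less_times_div mult_Suc_right add.commute not_gr_zero not_numeral_le_zero)
  also have "\<dots> \<le> q * (2 * M)" using M by (intro mult_left_mono) auto
  finally have "real N \<le> (2 * real q) * real M" by (metis less_imp_le mult.assoc mult.commute of_nat_le_iff of_nat_mult of_nat_numeral)
  moreover have N: "N > 0" using assms by (cases N) auto
  ultimately have "ln (real N) \<le> ln (2 * real q * real M)"
    using assms M by (subst ln_le_cancel_iff) auto
  also have "\<dots> = ln (2 * real q) + ln (real M)" using assms M by (simp add: ln_mult)
  finally have lnN: "1 + ln (real N) \<le> 1 + ln (2 * real q) + ln (real M)" by simp
  have lq: "ln (2 * real q) \<ge> 0" "ln (real M) \<ge> 0" using assms M by auto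
  then have "0 \<le> ln (2 * real q) * ln (real M)" by simp
  with lnN have "1 + ln (real N) \<le> (1 + ln (2 * real q)) * (1 + ln (real M))"
    by (simp add: algebra_simps)
  also have "\<dots> \<le> (2 * real q) * (1 + ln (real M))"
    using lq ln_le_minus_one[of "2 * real q"] assms by (intro mult_right_mono) auto
  \<comment> \<open>The fourth power already absorbs the logarithm since q \<ge> 2; as 3q/4 \<ge> 1,
    it may be raised to the 16th, whose root is then taken.\<close>
  also have "2 * real q \<le> (3/4 * real q) ^ 4"
  proof -
    have "2 ^ 3 \<le> real q ^ 3" using assms by (intro power_mono) auto
    then have "8 * real q \<le> real q ^ 3 * real q" by (intro mult_right_mono) auto
    then show ?thesis by (simp add: power_mult_distrib power_numeral_reduce)
  qed
  also have "\<dots> \<le> (3/4 * real q) ^ 16" using assms by (intro power_increasing) auto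
  finally have "1 + ln (real N) \<le> (3/4 * real q) ^ 16 * (1 + ln (real M))"
    using lq by (simp add: mult_right_mono)
  moreover have lnN0: "1 + ln (real N) > 0" using N by (simp add: add_pos_nonneg)
  ultimately have "(1 + ln (real N)) powr (1/16) \<le> ((3/4 * real q) ^ 16 * (1 + ln (real M))) powr (1/16)"
    by (intro powr_mono2) auto
  also have "\<dots> = ((3/4 * real q) ^ 16) powr (1/16) * (1 + ln (real M)) powr (1/16)"
    using lq by (intro powr_mult)
  also have "((3/4 * real q) ^ 16) powr (1/16) = 3/4 * real q"
  proof -
    have "(z ^ 16) powr (1/16) = z" if "z > 0" for z :: real
      using powr_realpow[OF that, of 16] powr_powr[of z 16 "1/16"] that by simp
    then show ?thesis using assms by simp
  qed
  finally have le: "(1 + ln (real N)) powr (1/16) \<le> 3/4 * real q * (1 + ln (real M)) powr (1/16)" .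
  have "1 + ln (real M) > 0" using lq by linarith
  then have "1 / (real q * (1 + ln (real M)) powr (1/16)) \<le> 3/4 / (1 + ln (real N)) powr (1/16)"
    using le lnN0 assms by (simp add: field_simps)
  then show ?thesis
    by (simp add: M_def powr_minus_divide mult.commute flip: minus_divide_left)
qed

lemma mert_0 [simp]: "mert Q 0 = 0"
  by (auto simp: mert_def rough_def intro: sum.neutral)

text \<open>The constant 4 B is the fixed point of x = B + (3/4) x, so strong induction along the
  recursion closes, with a constant independent of q.\<close>

lemma mert_insert_bound:
  assumes "prime q" "q \<notin> Q" "\<forall>r\<in>Q. prime r" "B \<ge> 0"
    and B: "\<And>N. N > 0 \<Longrightarrow> \<bar>mert Q N\<bar> \<le> B * damp N"
  shows "N > 0 \<Longrightarrow> \<bar>mert (insert q Q) N\<bar> \<le> 4 * B * damp N"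
proof (induction N rule: less_induct)
  case (less N)
  have q: "q \<ge> 2" using assms prime_ge_2_nat by blast
  have eq: "mert (insert q Q) N = mert Q N + mert (insert q Q) (N div q) / q"
    using mert_split[OF assms(1-3), of N] by simp
  have "\<bar>mert (insert q Q) (N div q) / q\<bar> \<le> 3 * B * damp N"
  proof (cases "N div q = 0")
    case True
    then show ?thesis using assms by simp
  next
    case False
    then have "N div q < N" "N div q > 0" using q less by auto
    then have "\<bar>mert (insert q Q) (N div q)\<bar> / q \<le> 4 * B * damp (N div q) / q"
      by (intro divide_right_mono less.IH) auto
    also have "\<dots> = 4 * B * (damp (N div q) / q)" by simp
    also have "\<dots> \<le> 4 * B * (3/4 * damp N)"
      using assms damp_div_le[OF q \<open>N div q > 0\<close>] by (intro mult_left_mono) auto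
    finally show ?thesis by simp
  qed
  with B[OF less.prems] show ?case
    unfolding eq using abs_triangle_ineq[of "mert Q N" "mert (insert q Q) (N div q) / q"] by linarith
qed

lemma mert_rough_bound:
  assumes "C > 0" "\<And>N. N > 0 \<Longrightarrow> \<bar>mert {} N\<bar> \<le> C * damp N" "finite Q" "\<forall>r\<in>Q. prime r" "N > 0"
  shows "\<bar>mert Q N\<bar> \<le> 4 ^ card Q * C * damp N"
  using assms(3-5)
proof (induction Q arbitrary: N)
  case empty
  then show ?case using assms by simp
next
  case (insert q Q)
  have "\<bar>mert (insert q Q) N\<bar> \<le> 4 * (4 ^ card Q * C) * damp N"
    by (rule mert_insert_bound) (use insert assms in auto)
  then show ?case using insert by (simp add: mult_ac)
qed

section \<open>The damped sum over primes tends to 0\<close>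

lemma tendsto_floor_log: "filterlim floor_log at_top sequentially"
proof (rule filterlim_at_top[THEN iffD2], rule allI)
  fix Z
  show "eventually (\<lambda>N. Z \<le> floor_log N) sequentially"
    using eventually_ge_at_top[of "2 ^ Z"]
  proof eventually_elim
    case (elim N)
    from floor_log_le_iff[OF this] show ?case by simp
  qed
qed

lemma sum_UN_le:
  fixes f :: "'a \<Rightarrow> real"
  assumes "finite I" "\<And>i. finite (A i)" "\<And>x. f x \<ge> 0"
  shows "sum f (\<Union>i\<in>I. A i) \<le> (\<Sum>i\<in>I. sum f (A i))"
  using assms(1)
proof (induction I)
  case (insert i I)
  have "sum f (A i \<union> (\<Union>i\<in>I. A i)) \<le> sum f (A i) + sum f (\<Union>i\<in>I. A i)"
    using insert assms sum_nonneg[of "A i \<inter> (\<Union>i\<in>I. A i)" f] by (subst sum_Un) auto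
  with insert show ?case by simp
qed simp

text \<open>Block j holds at most 4 * 2^j / (j+1) primes, each with 1/q \<le> 2^(-j). On it N/q is
  at least 2^(J-j-1) when j < J, so the damping depends only on J - j up to a factor 2; hence 8 = 4
  * 2.\<close>

lemma prime_sum_damp_bound:
  assumes "N > 0"
  defines "J \<equiv> floor_log N"
  shows "(\<Sum>q | prime q \<and> q \<le> N. damp (N div q) / q) \<le> 8 * (\<Sum>j\<le>J. 1 / Suc j * Suc (J - j) powr (-1/16))"
proof -
  define P where "P j = {q::nat. prime q \<and> 2 ^ j < q \<and> q \<le> 2 ^ Suc j}" for j
  let ?f = "\<lambda>q. damp (N div q) / real q"
  have finP: "finite (P j)" for j
    by (rule finite_subset[of _ "{..2 ^ Suc j}"]) (auto simp: P_def)
  have J: "2 ^ J \<le> N" unfolding J_def using assms by (intro floor_log_exp2_le) auto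
  have f0: "?f q \<ge> 0" for q by simp
  have "{q. prime q \<and> q \<le> N} \<subseteq> (\<Union>j\<le>J. P j \<inter> {..N})"
  proof safe
    fix q :: nat assume q: "prime q" "q \<le> N"
    \<comment> \<open>The blocks are open on the left and closed on the right, hence q - 1; this
      puts the prime 2 into block 0.\<close>
    define j where "j = floor_log (q - 1)"
    have q2: "q \<ge> 2" using q prime_ge_2_nat by blast
    have "2 ^ j \<le> q - 1" unfolding j_def using q2 by (intro floor_log_exp2_le) auto
    moreover have "q - 1 < 2 * 2 ^ j" unfolding j_def using q2 by (intro floor_log_exp2_gt)
    ultimately have "q \<in> P j" using q q2 by (auto simp: P_def)
    moreover have "j \<le> J" unfolding j_def J_def using q by (intro floor_log_le_iff) simp
    ultimately show "q \<in> (\<Union>j\<le>J. P j \<inter> {..N})" using q by auto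
  qed
  then have "sum ?f {q. prime q \<and> q \<le> N} \<le> sum ?f (\<Union>j\<le>J. P j \<inter> {..N})"
    using f0 by (intro sum_mono2) auto
  also have "\<dots> \<le> (\<Sum>j\<le>J. sum ?f (P j \<inter> {..N}))"
    using f0 by (intro sum_UN_le) auto
  also have "\<dots> \<le> (\<Sum>j\<le>J. 8 * (1 / Suc j * Suc (J - j) powr (-1/16)))"
  proof (rule sum_mono)
    fix j assume "j \<in> {..J}"
    then have j: "j \<le> J" by simp
    define b where "b = 2 * Suc (J - j) powr (-1/16) / 2 ^ j"
    have "?f q \<le> b" if q: "q \<in> P j \<inter> {..N}" for q
    proof -
      have q0: "q > 0" "q \<le> N" "2 ^ j < q" "q \<le> 2 ^ Suc j" using q by (auto simp: P_def prime_gt_0_nat)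
      then have M: "N div q \<ge> 1" by (simp add: Suc_le_eq div_greater_zero_iff)
      \<comment> \<open>Using only ln 2 \<ge> 1/2: 1 + (J - j - 1)/2 = (J - j + 1)/2. The case J = j
        is separate because of the truncated subtraction.\<close>
      have "real (Suc (J - j)) / 2 \<le> 1 + ln (real (N div q))"
      proof (cases "J = j")
        case True
        then show ?thesis using M by (simp add: add_increasing2)
      next
        case False
        then have "J = (J - j - 1) + Suc j" using j by simp
        then have "2 ^ (J - j - 1) * q \<le> 2 ^ J"
          using q0 by (metis mult_le_mono2 power_add)
        then have "2 ^ (J - j - 1) \<le> N div q"
          using J q0 by (simp add: less_eq_div_iff_mult_less_eq)
        then have "real (2 ^ (J - j - 1)) \<le> real (N div q)" by (simp only: of_nat_le_iff)
        then have "ln (real (2 ^ (J - j - 1))) \<le> ln (real (N div q))"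
          using M by (subst ln_le_cancel_iff) auto
        then have "ln (2 ^ (J - j - 1)) \<le> ln (real (N div q))" by (simp only: of_nat_power of_nat_numeral)
        then have "real (J - j - 1) * ln 2 \<le> ln (real (N div q))" by (simp add: ln_realpow)
        moreover have "real (J - j - 1) * (1/2) \<le> real (J - j - 1) * ln 2"
          using ln2_ge_two_thirds by (intro mult_left_mono) auto
        ultimately show ?thesis using False j by (simp add: of_nat_diff)
      qed
      then have "damp (N div q) \<le> (real (Suc (J - j)) / 2) powr (-1/16)"
        by (intro powr_mono2') auto
      also have "\<dots> = Suc (J - j) powr (-1/16) * 2 powr (1/16)"
        by (simp add: powr_divide powr_minus_divide flip: minus_divide_left)
      also have "(2::real) powr (1/16) \<le> 2 powr 1" by (intro powr_mono) auto
      finally have "damp (N div q) \<le> 2 * Suc (J - j) powr (-1/16)" by (simp add: mult_left_mono)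
      moreover have "(2::real) ^ j \<le> real q" using q0 by (metis less_imp_le of_nat_le_iff of_nat_numeral of_nat_power)
      ultimately show ?thesis unfolding b_def by (intro frac_le) auto
    qed
    then have "sum ?f (P j \<inter> {..N}) \<le> card (P j \<inter> {..N}) * b"
      by (rule sum_bounded_above)
    also have "\<dots> \<le> card (P j) * b"
      using finP by (intro mult_right_mono) (auto simp: b_def intro!: card_mono)
    also have "\<dots> \<le> (4 * 2 ^ j / Suc j) * b"
      using card_primes_dyadic[of j] by (intro mult_right_mono) (auto simp: b_def P_def)
    also have "\<dots> = 8 * (1 / Suc j * Suc (J - j) powr (-1/16))" by (simp add: b_def)
    finally show "sum ?f (P j \<inter> {..N}) \<le> 8 * (1 / Suc j * Suc (J - j) powr (-1/16))" .
  qed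
  finally show ?thesis by (simp add: sum_distrib_left)
qed

lemma harm_le_ln: "harm (Suc n) \<le> (1 + ln (real (Suc n)) :: real)"
  using decseqD[OF decseq_harm_diff_ln, of 0 n] by (simp add: harm_def)

text \<open>Of j and i = J - j one is at least J/2. If it is i, the damping factor is at most
  \<open>h\<close>. If it is j, then 1/(j+1) is split into the powers -1/16, which gives
  \<open>h\<close>, and -15/16, which is passed on to i and completes its damping factor to 1/(i+1).
  Two harmonic sums remain.\<close>

lemma convolution_bound:
  "(\<Sum>j\<le>J. 1 / Suc j * Suc (J - j) powr (-1/16)) \<le> 2 * (1 + J / 2) powr (-1/16) * (1 + ln (real (Suc J)))"
proof -
  define h where "h = (1 + real J / 2) powr (-1/16)"
  have "1 / Suc j * Suc (J - j) powr (-1/16) \<le> h * (1 / Suc j + 1 / Suc (J - j))" if j: "j \<le> J" for j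
  proof -
    define i where "i = J - j"
    have ij: "real i + real j = real J" using j by (simp add: i_def)
    show ?thesis
    proof (cases "j \<le> i")
      case True
      then have "real (Suc i) powr (-1/16) \<le> h"
        unfolding h_def using ij by (intro powr_mono2') auto
      then have "1 / Suc j * Suc i powr (-1/16) \<le> 1 / Suc j * h" by (intro mult_left_mono) auto
      also have "\<dots> \<le> h * (1 / Suc j + 1 / Suc i)" by (simp add: h_def algebra_simps)
      finally show ?thesis by (simp add: i_def)
    next
      case False
      then have "real (Suc j) powr (-1/16) \<le> h"
        unfolding h_def using ij by (intro powr_mono2') auto
      moreover have "real (Suc j) powr (-15/16) \<le> real (Suc i) powr (-15/16)"
        using False by (intro powr_mono2') auto
      ultimately have "real (Suc j) powr (-1/16) * real (Suc j) powr (-15/16) * Suc i powr (-1/16)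
          \<le> h * real (Suc i) powr (-15/16) * Suc i powr (-1/16)"
        by (intro mult_mono) (auto simp: h_def)
      moreover have "real (Suc n) powr (-1/16) * real (Suc n) powr (-15/16) = 1 / Suc n" for n
        by (simp add: powr_minus_divide flip: powr_add)
      ultimately have "1 / Suc j * Suc i powr (-1/16) \<le> h * (1 / Suc i)" 
        by (simp only: mult.assoc) (simp only: mult.commute)
      also have "\<dots> \<le> h * (1 / Suc j + 1 / Suc i)" by (simp add: h_def algebra_simps)
      finally show ?thesis by (simp add: i_def)
    qed
  qed
  then have "(\<Sum>j\<le>J. 1 / Suc j * Suc (J - j) powr (-1/16)) \<le> (\<Sum>j\<le>J. h * (1 / Suc j + 1 / Suc (J - j)))"
    by (intro sum_mono) auto
  also have "\<dots> = h * ((\<Sum>j\<le>J. 1 / Suc j) + (\<Sum>j\<le>J. 1 / Suc (J - j)))"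
    by (simp add: sum.distrib flip: sum_distrib_left)
  also have "(\<Sum>j\<le>J. 1 / real (Suc (J - j))) = (\<Sum>j\<le>J. 1 / Suc j)"
    by (rule sum.reindex_bij_witness[of _ "\<lambda>j. J - j" "\<lambda>j. J - j"]) auto
  also have "(\<Sum>j\<le>J. 1 / real (Suc j)) = harm (Suc J)"
    by (simp add: harm_altdef lessThan_Suc_atMost inverse_eq_divide)
  also have "h * (harm (Suc J) + harm (Suc J)) \<le> h * (2 * (1 + ln (real (Suc J))))"
    using harm_le_ln[of J] by (intro mult_left_mono) (auto simp: h_def)
  also have "\<dots> = 2 * (1 + J / 2) powr (-1/16) * (1 + ln (real (Suc J)))"
    by (simp only: h_def mult_ac)
  finally show ?thesis .
qed

lemma prime_sum_damp_tendsto: "(\<lambda>N. \<Sum>q | prime q \<and> q \<le> N. damp (N div q) / q) \<longlonglongrightarrow> 0"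
proof (rule tendsto_sandwich[of "\<lambda>_. 0"])
  have "(\<lambda>J. 8 * (2 * (1 + real J / 2) powr (-1/16) * (1 + ln (real (Suc J))))) \<longlonglongrightarrow> 0"
    by real_asymp
  from filterlim_compose[OF this tendsto_floor_log]
  show "(\<lambda>N. 8 * (2 * (1 + real (floor_log N) / 2) powr (-1/16) * (1 + ln (real (Suc (floor_log N)))))) \<longlonglongrightarrow> 0" .
  show "eventually (\<lambda>N. (\<Sum>q | prime q \<and> q \<le> N. damp (N div q) / q)
     \<le> 8 * (2 * (1 + real (floor_log N) / 2) powr (-1/16) * (1 + ln (real (Suc (floor_log N)))))) sequentially"
    using eventually_gt_at_top[of 0]
  proof eventually_elim
    case (elim N)
    show ?case using prime_sum_damp_bound[OF elim] convolution_bound[of "floor_log N"] by linarith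
  qed
qed (auto intro!: always_eventually sum_nonneg)

lemma mert_tendsto:
  assumes "finite Q" "\<forall>r\<in>Q. prime r"
  shows "mert Q \<longlonglongrightarrow> 0" "mert_omega Q \<longlonglongrightarrow> 0"
proof -
  obtain C where C: "C > 0" "\<And>N. N > 0 \<Longrightarrow> \<bar>mert {} N\<bar> \<le> C * damp N"
    using mert_log_bound by blast
  have bound: "\<bar>mert Q N\<bar> \<le> 4 ^ card Q * C * damp N" if "finite Q" "\<forall>r\<in>Q. prime r" "N > 0" for Q N
    by (rule mert_rough_bound[OF C(1) _ that]) (use C(2) in auto)
  have "(\<lambda>N. 4 ^ card Q * C * damp N) \<longlonglongrightarrow> 0" by real_asymp
  then show "mert Q \<longlonglongrightarrow> 0"
    by (rule Lim_null_comparison[rotated])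
       (rule eventually_mono[OF eventually_gt_at_top[of 0]], use bound[OF assms] in simp)
  \<comment> \<open>For q outside Q all the sets \<open>insert q Q\<close> have the same
    cardinality, so one constant serves every q.\<close>
  define D where "D = 4 ^ Suc (card Q) * C"
  have D: "D \<ge> 0" using C by (simp add: D_def)
  have le: "norm (mert_omega Q N) \<le> D * (\<Sum>q | prime q \<and> q \<le> N. damp (N div q) / q)" for N
  proof -
    have "norm (mert_omega Q N) \<le> (\<Sum>q | prime q \<and> q \<notin> Q \<and> q \<le> N. \<bar>mert (insert q Q) (N div q) / q\<bar>)"
      unfolding mert_omega_eq[OF assms(2)] by (simp only: abs_minus_cancel real_norm_def) (rule sum_abs)
    also have "\<dots> \<le> (\<Sum>q | prime q \<and> q \<notin> Q \<and> q \<le> N. D * (damp (N div q) / q))"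
    proof (rule sum_mono)
      fix q assume "q \<in> {q. prime q \<and> q \<notin> Q \<and> q \<le> N}"
      then have q: "prime q" "q \<notin> Q" "q \<le> N" by auto
      then have "N div q > 0" using prime_gt_0_nat by (simp add: div_greater_zero_iff)
      then have "\<bar>mert (insert q Q) (N div q)\<bar> \<le> 4 ^ card (insert q Q) * C * damp (N div q)"
        using assms q by (intro bound) auto
      also have "\<dots> = D * damp (N div q)" using q assms by (simp add: D_def)
      finally have "\<bar>mert (insert q Q) (N div q)\<bar> / q \<le> D * damp (N div q) / q"
        by (rule divide_right_mono) simp
      then show "\<bar>mert (insert q Q) (N div q) / q\<bar> \<le> D * (damp (N div q) / q)" by simp
    qed
    also have "\<dots> \<le> (\<Sum>q | prime q \<and> q \<le> N. D * (damp (N div q) / q))"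
      using D by (intro sum_mono2) auto
    finally show ?thesis by (simp add: sum_distrib_left)
  qed
  have "(\<lambda>N. D * (\<Sum>q | prime q \<and> q \<le> N. damp (N div q) / q)) \<longlonglongrightarrow> D * 0"
    by (intro tendsto_mult tendsto_const prime_sum_damp_tendsto)
  then have lim: "(\<lambda>N. D * (\<Sum>q | prime q \<and> q \<le> N. damp (N div q) / q)) \<longlonglongrightarrow> 0"
    by (simp only: mult_zero_right)
  show "mert_omega Q \<longlonglongrightarrow> 0"
    by (rule Lim_null_comparison[OF always_eventually[OF allI[OF le]] lim])
qed

section \<open>Integers with prescribed smallest prime factor\<close>

lemma smallest_prime_factor_eq_iff:
  assumes "prime p"
  shows "n \<ge> 2 \<and> smallest_prime_factor n = p \<longleftrightarrow> n \<in> (*) p ` rough {q. prime q \<and> q < p}"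
proof
  assume n: "n \<ge> 2 \<and> smallest_prime_factor n = p"
  then have ne: "prime_factors n \<noteq> {}" by (auto simp: prime_factorization_empty_iff)
  have "smallest_prime_factor n = Min (prime_factors n)" using n by (simp add: smallest_prime_factor_def)
  with n have Min: "Min (prime_factors n) = p" by (simp only:)
  then have "p \<in> prime_factors n" using Min_in[OF finite_set_mset ne] by (simp only:)
  then have "p dvd n" by (rule in_prime_factors_imp_dvd)
  \<comment> \<open>The cofactor k may again be divisible by p; only primes below p are
    excluded.\<close>
  then obtain k where k: "n = p * k" by (rule dvdE)
  have k0: "k > 0" using n k by (cases k) auto
  have "\<not> q dvd k" if "prime q" "q < p" for q
  proof
    assume "q dvd k"
    then have "q dvd n" using k by simp
    moreover have "n \<noteq> 0" using n by linarith
    ultimately have "q \<in> prime_factors n" using that by (intro prime_factorsI)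
    from Min_le[OF finite_set_mset this] have "p \<le> q" unfolding Min .
    with that show False by simp
  qed
  with k0 have "k \<in> rough {q. prime q \<and> q < p}" by (auto simp: rough_def)
  then show "n \<in> (*) p ` rough {q. prime q \<and> q < p}" using k by blast
next
  assume "n \<in> (*) p ` rough {q. prime q \<and> q < p}"
  then obtain k where k: "n = p * k" "k > 0" "\<And>q. prime q \<Longrightarrow> q < p \<Longrightarrow> \<not> q dvd k"
    by (auto simp: rough_def)
  have p2: "p \<ge> 2" using assms prime_ge_2_nat by blast
  then have n2: "n \<ge> 2" using k by (metis One_nat_def Suc_leI dual_order.trans mult_le_mono2 nat_mult_1_right)
  moreover have "Min (prime_factors n) = p"
  proof (rule Min_eqI)
    show "p \<in> prime_factors n" using k n2 assms by (auto simp: in_prime_factors_iff)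
    fix q assume "q \<in> prime_factors n"
    then have q: "prime q" "q dvd p * k" using k by (auto simp: in_prime_factors_iff)
    then have "q = p \<or> q dvd k" using assms by (metis prime_dvd_mult_iff primes_dvd_imp_eq)
    then show "p \<le> q" using k(3)[OF q(1)] by force
  qed simp
  ultimately show "n \<ge> 2 \<and> smallest_prime_factor n = p" by (simp add: smallest_prime_factor_def)
qed

lemma moebius_omega_sums:
  assumes "prime p"
  shows "(\<lambda>n. if n \<ge> 2 \<and> smallest_prime_factor n = p
             then real_of_int (moebius n) * real (omega n) / real n else 0) sums 0"
proof -
  define Q where "Q = {q. prime q \<and> q < p}"
  have Q: "finite Q" "\<forall>r\<in>Q. prime r" "p \<notin> Q" by (auto simp: Q_def)
  have p0: "p > 0" using assms prime_gt_0_nat by blast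
  let ?g = "\<lambda>n. real_of_int (moebius n) * real (omega n) / real n"
  have "(\<Sum>n\<le>N. if n \<ge> 2 \<and> smallest_prime_factor n = p then ?g n else 0)
      = - (mert_omega (insert p Q) (N div p) + mert (insert p Q) (N div p)) / p" for N
  proof -
    have "(\<Sum>n\<le>N. if n \<ge> 2 \<and> smallest_prime_factor n = p then ?g n else 0)
        = sum ?g {n \<in> {..N}. n \<ge> 2 \<and> smallest_prime_factor n = p}"
      by (rule sum.inter_filter [symmetric]) simp
    also have "{n \<in> {..N}. n \<ge> 2 \<and> smallest_prime_factor n = p} = (*) p ` rough Q \<inter> {..N}"
      using smallest_prime_factor_eq_iff[OF assms] by (auto simp: Q_def)
    also have "sum ?g \<dots> = (\<Sum>k\<in>rough Q \<inter> {..N div p}. ?g (p * k))"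
      using p0 by (simp add: image_mult_atMost sum.reindex inj_on_mult_nat)
    \<comment> \<open>Cofactors divisible by p drop out, since then p^2 divides n and \<mu>(n) =
      0.\<close>
    also have "\<dots> = (\<Sum>k\<in>rough (insert p Q) \<inter> {..N div p}. ?g (p * k))"
      by (rule sum.mono_neutral_right) (auto simp: rough_def moebius_prime_mult_dvd[OF assms])
    also have "\<dots> = (\<Sum>k\<in>rough (insert p Q) \<inter> {..N div p}. - (moebius k * omega k / k + moebius k / k) / p)"
    proof (rule sum.cong[OF refl])
      fix k assume "k \<in> rough (insert p Q) \<inter> {..N div p}"
      then have k: "\<not> p dvd k" "k > 0" by (auto simp: rough_def)
      show "?g (p * k) = - (moebius k * omega k / k + moebius k / k) / p"
        unfolding moebius_prime_mult[OF assms k] omega_prime_mult[OF assms k]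
        using k p0 by (simp add: field_simps)
    qed
    finally show ?thesis
      by (simp add: mert_def mert_omega_def sum_subtractf sum_negf flip: sum_divide_distrib)
  qed
  moreover have "(\<lambda>N. - (mert_omega (insert p Q) (N div p) + mert (insert p Q) (N div p)) / p) \<longlonglongrightarrow> - (0 + 0) / p"
  proof -
    have "filterlim (\<lambda>N. N div p) at_top sequentially"
      unfolding filterlim_at_top
    proof
      fix Z
      show "eventually (\<lambda>N. Z \<le> N div p) sequentially"
        using eventually_ge_at_top[of "Z * p"]
        by eventually_elim (use p0 in \<open>simp add: less_eq_div_iff_mult_less_eq\<close>)
    qed
    moreover have "finite (insert p Q)" "\<forall>r\<in>insert p Q. prime r" using Q assms by auto
    ultimately show ?thesis
      by (intro tendsto_intros filterlim_compose[OF mert_tendsto(1)] filterlim_compose[OF mert_tendsto(2)]) (use p0 in auto)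
  qed
  ultimately show ?thesis unfolding sums_def_le by simp
qed

theorem theorem11:
  fixes p :: nat
  assumes "prime p"
  shows "summable (\<lambda>n. if n \<ge> 2 \<and> smallest_prime_factor n = p
             then real_of_int (moebius n) * real (omega n) / real n else 0)
       \<and> summable (\<lambda>n. if n \<ge> 1 \<and> smallest_prime_factor n = p
             then real_of_int (moebius n) * real (omega n) / real n else 0)
       \<and> (\<Sum>n. if n \<ge> 1 \<and> smallest_prime_factor n = p
             then real_of_int (moebius n) * real (omega n) / real n else 0)
         = (\<Sum>n. if n \<ge> 2 \<and> smallest_prime_factor n = p
             then real_of_int (moebius n) * real (omega n) / real n else 0)
       \<and> (\<Sum>n. if n \<ge> 2 \<and> smallest_prime_factor n = p
             then real_of_int (moebius n) * real (omega n) / real n else 0) = 0"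
proof -
  \<comment> \<open>At n = 1 the default value 0 differs from the prime p, so both conditions select
    the same n.\<close>
  have "n \<ge> 1 \<and> smallest_prime_factor n = p \<longleftrightarrow> n \<ge> 2 \<and> smallest_prime_factor n = p" for n
    using prime_gt_0_nat[OF assms] by (auto simp: smallest_prime_factor_def split: if_splits)
  then show ?thesis using moebius_omega_sums[OF assms] by (simp add: sums_iff)
qed

end
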